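(* There exists a numerical constant $C>0$ such that for all integers $n\geq 1$ and $p\ge 1$ and any $1\le k\le p$, $$R^*(k)\ge C\left(\left\{\left[\frac kn\log\left(1+\frac{p}{k^2}\vee\sqrt{\frac{p}{k^2}}\right)\right]^2\wedge1\right\}+\frac1n\right).$$
   Context: For $\beta\in\mathbb{R}^p$, $\sigma>0$, $\mathbb{E}_{\beta,\sigma}$ denotes expectation under the law of $(Y,\mathbf{X})$ where $\mathbf{X}\in\mathbb{R}^{n\times p}$ has i.i.d. rows $\mathcal{N}(0,\mathbf{I}_p)$, $Y=\mathbf{X}\beta+\epsilon$ and $\epsilon\sim\mathcal{N}(0,\sigma^2\mathbf{I}_n)$ is independent of $\mathbf{X}$. Set $\eta(\beta,\sigma):=\frac{\|\beta\|_2^2}{\sigma^2+\|\beta\|_2^2}$. $\mathbb{B}_0[k]$ is the set of vectors of $\mathbb{R}^p$ with at most $k$ nonzero coordinates. For an estimator $\widehat\eta$ (a measurable function of $(Y,\mathbf{X})$), the maximal risk is $$R(\widehat\eta,k):=\sup_{\beta\in\mathbb{B}_0[k],\ \sigma>0}\mathbb{E}_{\beta,\sigma}\left[\{\widehat\eta-\eta(\beta,\sigma)\}^2\right],$$ and the minimax risk is $R^*(k):=\inf_{\widehat\eta}R(\widehat\eta,k)$. Here $a\vee b=\max(a,b)$ and $a\wedge b=\min(a,b)$. *)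

theory Defs
  imports "HOL-Probability.Probability"
begin

text \<open>
  Since the constant in the theorem must not depend on the dimensions, a vector of length \<open>m\<close> is a
  function in \<open>{..<m} \<rightarrow>\<^sub>E UNIV\<close>, and an \<open>n \<times> p\<close> matrix is the family of its \<open>n\<close> rows.
\<close>

text \<open>The law \<open>N(0, \<sigma>\<^sup>2 I\<^sub>m)\<close>: \<open>normal_density\<close> is parametrised by the standard deviation.\<close>

definition gaussian_vector :: "nat \<Rightarrow> real \<Rightarrow> (nat \<Rightarrow> real) measure" where
  "gaussian_vector m \<sigma> = PiM {..<m} (\<lambda>_. density lborel (normal_density 0 \<sigma>))"

definition gaussian_design :: "nat \<Rightarrow> nat \<Rightarrow> (nat \<Rightarrow> nat \<Rightarrow> real) measure" where
  "gaussian_design n p = PiM {..<n} (\<lambda>_. gaussian_vector p 1)"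

definition obs_space :: "nat \<Rightarrow> nat \<Rightarrow> ((nat \<Rightarrow> real) \<times> (nat \<Rightarrow> nat \<Rightarrow> real)) measure" where
  "obs_space n p = PiM {..<n} (\<lambda>_. borel) \<Otimes>\<^sub>M PiM {..<n} (\<lambda>_. PiM {..<p} (\<lambda>_. borel))"

definition response ::
  "nat \<Rightarrow> nat \<Rightarrow> (nat \<Rightarrow> real) \<Rightarrow> (nat \<Rightarrow> nat \<Rightarrow> real) \<Rightarrow> (nat \<Rightarrow> real) \<Rightarrow> nat \<Rightarrow> real" where
  "response n p \<beta> X \<epsilon> = (\<lambda>i\<in>{..<n}. (\<Sum>j<p. X i j * \<beta> j) + \<epsilon> i)"

text \<open>The product measure encodes the independence of the design and the noise.\<close>

definition regression_law ::
  "nat \<Rightarrow> nat \<Rightarrow> (nat \<Rightarrow> real) \<Rightarrow> real \<Rightarrow> ((nat \<Rightarrow> real) \<times> (nat \<Rightarrow> nat \<Rightarrow> real)) measure" where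
  "regression_law n p \<beta> \<sigma> =
     distr (gaussian_design n p \<Otimes>\<^sub>M gaussian_vector n \<sigma>) (obs_space n p)
       (\<lambda>(X, \<epsilon>). (response n p \<beta> X \<epsilon>, X))"

definition explained_variance :: "nat \<Rightarrow> (nat \<Rightarrow> real) \<Rightarrow> real \<Rightarrow> real" where
  "explained_variance p \<beta> \<sigma> = (\<Sum>j<p. (\<beta> j)\<^sup>2) / (\<sigma>\<^sup>2 + (\<Sum>j<p. (\<beta> j)\<^sup>2))"

definition sparse_vectors :: "nat \<Rightarrow> nat \<Rightarrow> (nat \<Rightarrow> real) set" where
  "sparse_vectors p k = {\<beta> \<in> {..<p} \<rightarrow>\<^sub>E UNIV. card {j \<in> {..<p}. \<beta> j \<noteq> 0} \<le> k}"

text \<open>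
  Estimators are real-valued but need not be bounded, so their quadratic risk may be infinite;
  it is therefore a nonnegative integral with values in \<open>ennreal\<close>.
\<close>

definition max_risk ::
  "nat \<Rightarrow> nat \<Rightarrow> nat \<Rightarrow> ((nat \<Rightarrow> real) \<times> (nat \<Rightarrow> nat \<Rightarrow> real) \<Rightarrow> real) \<Rightarrow> ennreal" where
  "max_risk n p k \<eta>' =
     (SUP \<beta>\<in>sparse_vectors p k. SUP \<sigma>\<in>{0<..}.
        \<integral>\<^sup>+ \<omega>. ennreal ((\<eta>' \<omega> - explained_variance p \<beta> \<sigma>)\<^sup>2) \<partial>regression_law n p \<beta> \<sigma>)"

definition minimax_risk :: "nat \<Rightarrow> nat \<Rightarrow> nat \<Rightarrow> ennreal" where
  "minimax_risk n p k = (INF \<eta>'\<in>borel_measurable (obs_space n p). max_risk n p k \<eta>')"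

text \<open>
  The following lemmas show that the map used in \<open>regression_law\<close> is measurable, so that \<open>distr\<close>
  is the genuine image measure and \<open>regression_law\<close> a probability measure.
\<close>

lemma sets_gaussian_vector: "sets (gaussian_vector m \<sigma>) = sets (PiM {..<m} (\<lambda>_. borel))"
  unfolding gaussian_vector_def by (intro sets_PiM_cong) auto

lemma sets_gaussian_design:
  "sets (gaussian_design n p) = sets (PiM {..<n} (\<lambda>_. PiM {..<p} (\<lambda>_. borel)))"
  unfolding gaussian_design_def by (intro sets_PiM_cong) (auto simp: sets_gaussian_vector)

lemma regression_map_measurable:
  "(\<lambda>(X, \<epsilon>). (response n p \<beta> X \<epsilon>, X))
     \<in> measurable (gaussian_design n p \<Otimes>\<^sub>M gaussian_vector n \<sigma>) (obs_space n p)"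
proof -
  let ?D = "PiM {..<n} (\<lambda>_. PiM {..<p} (\<lambda>_. borel :: real measure))"
  let ?N = "PiM {..<n} (\<lambda>_. borel :: real measure)"
  have X: "(\<lambda>x. fst x i j) \<in> borel_measurable (?D \<Otimes>\<^sub>M ?N)" if "i < n" "j < p" for i j
  proof -
    have "(\<lambda>x. fst x i) \<in> measurable (?D \<Otimes>\<^sub>M ?N) (PiM {..<p} (\<lambda>_. borel))"
      using that by (intro measurable_compose[OF measurable_fst] measurable_component_singleton) simp
    then show ?thesis
      by (rule measurable_compose) (use that in \<open>intro measurable_component_singleton, simp\<close>)
  qed
  have e: "(\<lambda>x. snd x i) \<in> borel_measurable (?D \<Otimes>\<^sub>M ?N)" if "i < n" for i
    using that by (intro measurable_compose[OF measurable_snd] measurable_component_singleton) simp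
  have "(\<lambda>(X, \<epsilon>). (response n p \<beta> X \<epsilon>, X)) \<in> measurable (?D \<Otimes>\<^sub>M ?N) (?N \<Otimes>\<^sub>M ?D)"
    unfolding response_def split_beta
    by (intro measurable_Pair measurable_restrict borel_measurable_add borel_measurable_sum
          borel_measurable_times borel_measurable_const measurable_fst X e) auto
  then show ?thesis
    unfolding obs_space_def
    by (subst measurable_cong_sets[OF
          sets_pair_measure_cong[OF sets_gaussian_design sets_gaussian_vector] refl])
qed

lemma prob_space_regression_law:
  assumes "\<sigma> > 0"
  shows "prob_space (regression_law n p \<beta> \<sigma>)"
proof -
  have gv: "prob_space (gaussian_vector m s)" if "s > 0" for m s
    unfolding gaussian_vector_def by (intro prob_space_PiM prob_space_normal_density that)
  have gd: "prob_space (gaussian_design n p)"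
    unfolding gaussian_design_def by (intro prob_space_PiM gv) simp
  interpret pair_prob_space "gaussian_design n p" "gaussian_vector n \<sigma>"
    using gd gv[OF assms] by (simp add: pair_prob_space_def pair_sigma_finite_def prob_space_imp_sigma_finite)
  show ?thesis
    unfolding regression_law_def by (intro prob_space_distr regression_map_measurable)
qed

end

theory Submission
  imports Defs
begin

text \<open>
  If \<open>L\<close> is the likelihood ratio of two (possibly mixed) hypotheses whose parameter values differ by
  \<open>d\<close>, then every estimator has maximal quadratic risk at least \<open>d\<^sup>2 / (2 (1 + E L\<^sup>2))\<close>.

  The term \<open>1 / n\<close> comes from fixing \<open>\<beta>\<close> as a unit vector and comparing \<open>\<sigma>\<^sup>2 = 1\<close> with
  \<open>\<sigma>\<^sup>2 = 1 - 1 / (2 sqrt n)\<close>. For the other term \<open>\<beta> = 0\<close>, \<open>\<sigma> = 1\<close> is compared with \<open>\<sigma>\<^sup>2 = 1 - \<theta>\<close> and \<open>\<beta>\<close> a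
  random vector with \<open>k\<close> equal nonzero coordinates and \<open>\<parallel>\<beta>\<parallel>\<^sup>2 = \<theta>\<close>. The second moment of the mixed
  likelihood ratio is the mean of \<open>(1 - \<langle>\<beta>, \<beta>'\<rangle>)\<^sup>-\<^sup>n\<close> over independent copies, which is at most
  the mean of \<open>exp (2 n \<theta> Z / k)\<close> for a binomial \<open>Z\<close> with mean of order \<open>k\<^sup>2 / p\<close>; it stays bounded for
  \<open>\<theta>\<close> of order \<open>k / n * ln (1 + p / k\<^sup>2)\<close>. If \<open>k\<^sup>2 > p\<close>, then \<open>k\<close> is replaced by \<open>\<lfloor>sqrt p\<rfloor>\<close>.
\<close>

section \<open>Gaussian integrals for a single row of the model\<close>

lemma nn_integral_normal_density:
  assumes "\<sigma> > 0"
  shows "(\<integral>\<^sup>+ x. ennreal (normal_density \<mu> \<sigma> x) \<partial>lborel) = 1"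
  using assms by (simp add: nn_integral_eq_integral)

text \<open>Squaring doubles the exponent, so the square of a centred Gaussian density is again one
  up to a factor, with half the variance.\<close>

lemma normal_density_power2:
  assumes "\<sigma> > 0"
  shows "(normal_density 0 \<sigma> y)\<^sup>2 = normal_density 0 (\<sigma> / sqrt 2) y / (2 * \<sigma> * sqrt pi)"
proof -
  have "(exp (- (y - 0)\<^sup>2 / (2 * \<sigma>\<^sup>2)))\<^sup>2 = exp (- (y - 0)\<^sup>2 / (2 * (\<sigma> / sqrt 2)\<^sup>2))"
    by (simp add: power2_eq_square exp_add [symmetric])
  moreover have "(1 / sqrt (2 * pi * \<sigma>\<^sup>2))\<^sup>2 = 1 / sqrt (2 * pi * (\<sigma> / sqrt 2)\<^sup>2) / (2 * \<sigma> * sqrt pi)"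
    using assms by (simp add: real_sqrt_mult power_divide power_mult_distrib power2_eq_square)
  ultimately show ?thesis
    unfolding normal_density_def power_mult_distrib by simp
qed

text \<open>The quotient is an unnormalised Gaussian of precision
  \<open>1 / \<rho>\<^sup>2 - 1\<close>, which is positive because \<open>\<rho> < 1\<close>;
  \<open>\<tau>\<close> is its standard deviation.\<close>

lemma nn_integral_normal_density_ratio:
  assumes "0 < \<rho>" "\<rho> < 1"
  shows "(\<integral>\<^sup>+ y. ennreal (normal_density 0 \<rho> y / normal_density 0 1 y) \<partial>lborel)
           = ennreal (sqrt (2 * pi) / sqrt (1 - \<rho>\<^sup>2))"
proof -
  have less: "\<rho>\<^sup>2 < 1"
    using assms by (simp add: power_less_one_iff abs_square_less_1)
  define \<tau> where "\<tau> = \<rho> / sqrt (1 - \<rho>\<^sup>2)"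
  have \<tau>: "\<tau> > 0" "\<tau>\<^sup>2 = \<rho>\<^sup>2 / (1 - \<rho>\<^sup>2)"
    using assms less by (simp_all add: \<tau>_def power_divide)
  have "normal_density 0 \<rho> y / normal_density 0 1 y
      = sqrt (2 * pi) / sqrt (1 - \<rho>\<^sup>2) * normal_density 0 \<tau> y" for y
  proof -
    have "exp (- (y - 0)\<^sup>2 / (2 * \<rho>\<^sup>2)) / exp (- (y - 0)\<^sup>2 / (2 * 1\<^sup>2)) = exp (- (y - 0)\<^sup>2 / (2 * \<tau>\<^sup>2))"
      using assms less by (simp add: \<tau>(2) exp_diff [symmetric] field_simps)
    moreover have "sqrt (2 * pi * \<tau>\<^sup>2) = sqrt (2 * pi) * \<tau>" "sqrt (2 * pi * \<rho>\<^sup>2) = sqrt (2 * pi) * \<rho>"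
      using \<tau>(1) assms by (simp_all add: real_sqrt_mult)
    ultimately show ?thesis
      using assms less \<tau>(1) unfolding normal_density_def
      by (simp add: field_simps) (simp add: \<tau>_def)
  qed
  then show ?thesis
    using less nn_integral_normal_density[OF \<tau>(1), of 0]
    by (simp only:) (simp add: ennreal_mult nn_integral_cmult del: times_divide_eq_left)
qed

text \<open>This is a convolution of centred Gaussians with variances \<open>s\<^sup>2\<close> and
  \<open>b\<^sup>2\<close>. The case \<open>b = 0\<close> is separate because the substitution by
  \<open>b * x\<close> degenerates.\<close>

lemma nn_integral_normal_density_shift:
  assumes "s > 0"
  shows "(\<integral>\<^sup>+ x. ennreal (normal_density 0 s (y - b * x)) \<partial>std_normal_distribution)
           = ennreal (normal_density 0 (sqrt (s\<^sup>2 + b\<^sup>2)) y)"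
proof (cases "b = 0")
  case True
  then show ?thesis
    using assms prob_space.emeasure_space_1[OF prob_space_normal_density[of 1 0]] by simp
next
  case False
  have "normal_density 0 1 x = \<bar>b\<bar> * normal_density 0 \<bar>b\<bar> (b * x)" for x
    using False by (simp add: normal_density_def real_sqrt_mult power_mult_distrib)
  then have "(\<integral>\<^sup>+ x. ennreal (normal_density 0 s (y - b * x)) \<partial>std_normal_distribution)
      = ennreal \<bar>b\<bar> * (\<integral>\<^sup>+ x. ennreal (normal_density 0 s (y - b * x) * normal_density 0 \<bar>b\<bar> (b * x)) \<partial>lborel)"
    by (subst nn_integral_cmult [symmetric])
       (auto simp: nn_integral_density ennreal_mult' [symmetric] mult_ac)
  also have "\<dots> = (\<integral>\<^sup>+ x. ennreal (normal_density 0 s (y - x) * normal_density 0 \<bar>b\<bar> x) \<partial>lborel)"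
    using False by (subst (2) nn_integral_real_affine [where c = b and t = 0]) auto
  also have "\<dots> = ennreal (normal_density 0 (sqrt (s\<^sup>2 + b\<^sup>2)) y)"
    using conv_normal_density_zero_mean[of s "\<bar>b\<bar>"] assms False by (simp add: fun_eq_iff)
  finally show ?thesis .
qed

lemma product_sigma_finite_normal:
  assumes "\<And>i. \<sigma> i > 0"
  shows "product_sigma_finite (\<lambda>i. density lborel (normal_density (\<mu> i) (\<sigma> i)))"
  using assms by (simp add: product_sigma_finite_def prob_space_imp_sigma_finite prob_space_normal_density)

lemma product_sigma_finite_std_normal: "product_sigma_finite (\<lambda>_. std_normal_distribution)"
  using product_sigma_finite_normal[of "\<lambda>_. 1" "\<lambda>_. 0"] by simp

text \<open>Every coordinate enters at most one of the two linear forms, so integrating it out is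
  one convolution that adds its squared coefficient to one of the variances. The points
  \<open>y\<close> and \<open>z\<close> vary in the induction because each coordinate shifts
  them.\<close>

lemma nn_integral_linear_form_disjoint:
  fixes \<beta> \<beta>' :: "'i \<Rightarrow> real"
  assumes "finite J" "\<And>j. j \<in> J \<Longrightarrow> \<beta> j * \<beta>' j = 0" "0 < s" "0 < t"
  shows "(\<integral>\<^sup>+ x. ennreal (normal_density 0 s (y - (\<Sum>j\<in>J. x j * \<beta> j))
                        * normal_density 0 t (z - (\<Sum>j\<in>J. x j * \<beta>' j))) \<partial>PiM J (\<lambda>_. std_normal_distribution))
       = ennreal (normal_density 0 (sqrt (s\<^sup>2 + (\<Sum>j\<in>J. (\<beta> j)\<^sup>2))) y
                * normal_density 0 (sqrt (t\<^sup>2 + (\<Sum>j\<in>J. (\<beta>' j)\<^sup>2))) z)"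
  using assms(1,2)
proof (induction J arbitrary: y z)
  case empty
  interpret product_sigma_finite "\<lambda>_::'i. std_normal_distribution" by (rule product_sigma_finite_std_normal)
  show ?case using assms by (subst nn_integral_empty) simp_all
next
  case (insert i J)
  interpret product_sigma_finite "\<lambda>_::'i. std_normal_distribution" by (rule product_sigma_finite_std_normal)
  let ?s = "sqrt (s\<^sup>2 + (\<Sum>j\<in>J. (\<beta> j)\<^sup>2))" and ?t = "sqrt (t\<^sup>2 + (\<Sum>j\<in>J. (\<beta>' j)\<^sup>2))"
  have pos: "?s > 0" "?t > 0"
    using assms(3,4) by (simp_all add: add_pos_nonneg sum_nonneg)
  have sums: "(\<Sum>j\<in>insert i J. (x(i := v)) j * b j) = v * b i + (\<Sum>j\<in>J. x j * b j)" for x v and b :: "'i \<Rightarrow> real"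
    using insert.hyps by (simp add: sum.insert) (intro sum.cong, auto)
  have *: "(\<lambda>x. \<Sum>j\<in>insert i J. x j * b j) \<in> borel_measurable (Pi\<^sub>M (insert i J) (\<lambda>_. std_normal_distribution))" for b :: "'i \<Rightarrow> real"
    by measurable
  have "(\<integral>\<^sup>+ x. ennreal (normal_density 0 s (y - (\<Sum>j\<in>insert i J. x j * \<beta> j))
                * normal_density 0 t (z - (\<Sum>j\<in>insert i J. x j * \<beta>' j))) \<partial>PiM (insert i J) (\<lambda>_. std_normal_distribution))
     = (\<integral>\<^sup>+ v. (\<integral>\<^sup>+ x. ennreal (normal_density 0 s ((y - v * \<beta> i) - (\<Sum>j\<in>J. x j * \<beta> j))
                * normal_density 0 t ((z - v * \<beta>' i) - (\<Sum>j\<in>J. x j * \<beta>' j))) \<partial>PiM J (\<lambda>_. std_normal_distribution)) \<partial>std_normal_distribution)"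
    by (subst product_nn_integral_insert_rev, simp_all only: sums diff_diff_eq)
       (use * insert.hyps in auto)
  also have "\<dots> = (\<integral>\<^sup>+ v. ennreal (normal_density 0 ?s (y - \<beta> i * v) * normal_density 0 ?t (z - \<beta>' i * v)) \<partial>std_normal_distribution)"
    using insert.IH insert.prems by (simp add: mult.commute)
  also have "\<dots> = ennreal (normal_density 0 (sqrt (s\<^sup>2 + (\<Sum>j\<in>insert i J. (\<beta> j)\<^sup>2))) y
                * normal_density 0 (sqrt (t\<^sup>2 + (\<Sum>j\<in>insert i J. (\<beta>' j)\<^sup>2))) z)"
  proof -
    have "\<beta> i = 0 \<or> \<beta>' i = 0" using insert.prems by force
    moreover have *: "(sqrt (s\<^sup>2 + (\<Sum>j\<in>J. (\<beta> j)\<^sup>2)))\<^sup>2 = s\<^sup>2 + (\<Sum>j\<in>J. (\<beta> j)\<^sup>2)"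
       "(sqrt (t\<^sup>2 + (\<Sum>j\<in>J. (\<beta>' j)\<^sup>2)))\<^sup>2 = t\<^sup>2 + (\<Sum>j\<in>J. (\<beta>' j)\<^sup>2)" by (simp_all add: sum_nonneg)
    ultimately show ?thesis
      using insert.hyps nn_integral_normal_density_shift[OF pos(1), of y "\<beta> i"]
        nn_integral_normal_density_shift[OF pos(2), of z "\<beta>' i"]
      unfolding *
      by (elim disjE) (simp_all add: ennreal_mult' nn_integral_cmult nn_integral_multc algebra_simps)
  qed
  finally show ?case .
qed

text \<open>Integrating out \<open>B\<close> turns both factors into the density of variance
  \<open>\<tau>\<^sup>2\<close> at the same point, so their product is a square. A coordinate in
  \<open>A\<close> shifts both factors equally and thus acts on this square by a single
  convolution.\<close>

lemma nn_integral_linear_form_diagonal: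
  fixes \<beta> \<beta>' :: "'i \<Rightarrow> real"
  assumes "finite A" "finite B" "A \<inter> B = {}"
    and "\<And>j. j \<in> A \<Longrightarrow> \<beta> j = \<beta>' j" "\<And>j. j \<in> B \<Longrightarrow> \<beta> j * \<beta>' j = 0"
    and "0 < s" "0 < \<tau>" "s\<^sup>2 + (\<Sum>j\<in>B. (\<beta> j)\<^sup>2) = \<tau>\<^sup>2" "s\<^sup>2 + (\<Sum>j\<in>B. (\<beta>' j)\<^sup>2) = \<tau>\<^sup>2"
  shows "(\<integral>\<^sup>+ x. ennreal (normal_density 0 s (y - (\<Sum>j\<in>A \<union> B. x j * \<beta> j))
                        * normal_density 0 s (y - (\<Sum>j\<in>A \<union> B. x j * \<beta>' j)))
             \<partial>PiM (A \<union> B) (\<lambda>_. std_normal_distribution))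
       = ennreal (normal_density 0 (sqrt (\<tau>\<^sup>2 / 2 + (\<Sum>j\<in>A. (\<beta> j)\<^sup>2))) y / (2 * \<tau> * sqrt pi))"
  using assms(1,3,4)
proof (induction A arbitrary: y)
  case empty
  have "\<tau> / sqrt 2 = sqrt (\<tau>\<^sup>2 / 2)"
    using assms(7) by (simp add: real_sqrt_divide)
  then show ?case
    using nn_integral_linear_form_disjoint[OF assms(2,5,6,6), where y = y and z = y] assms(7-9)
      normal_density_power2[OF assms(7), of y]
    by (simp add: power2_eq_square)
next
  case (insert i A)
  interpret product_sigma_finite "\<lambda>_::'i. std_normal_distribution" by (rule product_sigma_finite_std_normal)
  have i: "i \<notin> A \<union> B" "finite (A \<union> B)"
    using insert.hyps insert.prems assms(2) by auto
  let ?u = "sqrt (\<tau>\<^sup>2 / 2 + (\<Sum>j\<in>A. (\<beta> j)\<^sup>2))"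
  have pos: "?u > 0"
    using assms(7) by (simp add: add_pos_nonneg sum_nonneg)
  have sums: "(\<Sum>j\<in>insert i (A \<union> B). (x(i := v)) j * b j) = v * b i + (\<Sum>j\<in>A \<union> B. x j * b j)"
    for x v and b :: "'i \<Rightarrow> real"
    using i by (simp add: sum.insert) (intro sum.cong, auto)
  have \<beta>i: "\<beta>' i = \<beta> i"
    using insert.prems(2)[of i] by simp
  have meas: "(\<lambda>x. \<Sum>j\<in>insert i (A \<union> B). x j * b j)
      \<in> borel_measurable (Pi\<^sub>M (insert i (A \<union> B)) (\<lambda>_. std_normal_distribution))" for b :: "'i \<Rightarrow> real"
    by measurable
  have "(\<integral>\<^sup>+ x. ennreal (normal_density 0 s (y - (\<Sum>j\<in>insert i (A \<union> B). x j * \<beta> j))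
                * normal_density 0 s (y - (\<Sum>j\<in>insert i (A \<union> B). x j * \<beta>' j)))
           \<partial>PiM (insert i (A \<union> B)) (\<lambda>_. std_normal_distribution))
     = (\<integral>\<^sup>+ v. (\<integral>\<^sup>+ x. ennreal (normal_density 0 s ((y - v * \<beta> i) - (\<Sum>j\<in>A \<union> B. x j * \<beta> j))
                * normal_density 0 s ((y - v * \<beta> i) - (\<Sum>j\<in>A \<union> B. x j * \<beta>' j)))
           \<partial>PiM (A \<union> B) (\<lambda>_. std_normal_distribution)) \<partial>std_normal_distribution)"
    by (subst product_nn_integral_insert_rev, simp_all only: sums diff_diff_eq \<beta>i)
       (use meas i in auto)
  also have "\<dots> = (\<integral>\<^sup>+ v. ennreal (normal_density 0 ?u (y - \<beta> i * v)) * ennreal (1 / (2 * \<tau> * sqrt pi))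
                     \<partial>std_normal_distribution)"
    using insert.IH insert.prems assms(7) by (simp add: mult.commute ennreal_mult' [symmetric])
  also have "\<dots> = ennreal (normal_density 0 (sqrt (?u\<^sup>2 + (\<beta> i)\<^sup>2)) y) * ennreal (1 / (2 * \<tau> * sqrt pi))"
    by (subst nn_integral_multc) (simp_all add: nn_integral_normal_density_shift[OF pos] del: real_sqrt_pow2_iff)
  also have "?u\<^sup>2 + (\<beta> i)\<^sup>2 = \<tau>\<^sup>2 / 2 + (\<Sum>j\<in>insert i A. (\<beta> j)\<^sup>2)"
    using insert.hyps by (simp add: sum_nonneg)
  finally show ?case
    using assms(7) by (simp add: ennreal_mult' [symmetric])
qed

text \<open>
  With noise variance \<open>1 - \<theta>\<close> the response has marginal law \<open>N(0, 1)\<close> as under the null hypothesis.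
  The coordinates in only one of the two supports are integrated out first; they turn both noise
  variances into \<open>1 - r\<close>, where \<open>r\<close> is the inner product of \<open>\<beta>\<close> and \<open>\<beta>'\<close>.
\<close>

lemma row_second_moment:
  fixes \<beta> \<beta>' :: "'i \<Rightarrow> real"
  assumes "finite J" "\<And>j. j \<in> J \<Longrightarrow> \<beta> j * \<beta>' j = 0 \<or> \<beta> j = \<beta>' j"
    and "(\<Sum>j\<in>J. (\<beta> j)\<^sup>2) = \<theta>" "(\<Sum>j\<in>J. (\<beta>' j)\<^sup>2) = \<theta>" "\<theta> < 1"
  shows "(\<integral>\<^sup>+ x. (\<integral>\<^sup>+ y. ennreal (normal_density (\<Sum>j\<in>J. x j * \<beta> j) (sqrt (1 - \<theta>)) y
                * normal_density (\<Sum>j\<in>J. x j * \<beta>' j) (sqrt (1 - \<theta>)) y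
                / std_normal_density y) \<partial>lborel) \<partial>PiM J (\<lambda>_. std_normal_distribution))
       = ennreal (1 / (1 - (\<Sum>j\<in>J. \<beta> j * \<beta>' j)))"
proof -
  let ?P = "PiM J (\<lambda>_::'i. std_normal_distribution)"
  let ?s = "sqrt (1 - \<theta>)"
  define A where "A = {j \<in> J. \<beta> j * \<beta>' j \<noteq> 0}"
  define B where "B = {j \<in> J. \<beta> j * \<beta>' j = 0}"
  define r where "r = (\<Sum>j\<in>J. \<beta> j * \<beta>' j)"
  have fin: "finite A" "finite B" "A \<inter> B = {}" and J: "J = A \<union> B"
    using assms(1) by (auto simp: A_def B_def)
  have AB: "\<And>j. j \<in> A \<Longrightarrow> \<beta> j = \<beta>' j" "\<And>j. j \<in> B \<Longrightarrow> \<beta> j * \<beta>' j = 0"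
    using assms(2) by (auto simp: A_def B_def)
  have split: "(\<Sum>j\<in>J. f j) = (\<Sum>j\<in>A. f j) + (\<Sum>j\<in>B. f j)" for f :: "'i \<Rightarrow> real"
    unfolding J by (rule sum.union_disjoint) (use fin in auto)
  have rA: "r = (\<Sum>j\<in>A. (\<beta> j)\<^sup>2)" "r = (\<Sum>j\<in>A. (\<beta>' j)\<^sup>2)"
    unfolding r_def split using AB by (auto simp: power2_eq_square intro!: sum.cong sum.neutral)
  have sB: "(\<Sum>j\<in>B. (\<beta> j)\<^sup>2) = \<theta> - r" "(\<Sum>j\<in>B. (\<beta>' j)\<^sup>2) = \<theta> - r"
    using assms(3,4) rA split[of "\<lambda>j. (\<beta> j)\<^sup>2"] split[of "\<lambda>j. (\<beta>' j)\<^sup>2"] by auto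
  have "r \<le> \<theta>"
    using sB(1) sum_nonneg[of B "\<lambda>j. (\<beta> j)\<^sup>2"] by simp
  have r0: "0 \<le> r"
    using rA(1) by (simp add: sum_nonneg)
  have r1: "r < 1"
    using \<open>r \<le> \<theta>\<close> assms(5) by simp
  define \<tau> where "\<tau> = sqrt (1 - r)"
  have \<tau>: "\<tau> > 0" "\<tau>\<^sup>2 = 1 - r"
    using r1 by (simp_all add: \<tau>_def)
  \<comment> \<open>The variance after the row is integrated out: \<open>\<tau>\<^sup>2 / 2\<close>
    from the squared density plus \<open>r\<close> from the common coordinates.\<close>
  define \<rho> where "\<rho> = sqrt ((1 + r) / 2)"
  have \<rho>: "\<rho> > 0" "\<rho> < 1" "\<rho>\<^sup>2 = (1 + r) / 2"
    using r0 r1 by (simp_all add: \<rho>_def)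
  have s: "?s > 0" "?s\<^sup>2 = 1 - \<theta>"
    using assms(5) by simp_all
  interpret product_sigma_finite "\<lambda>_::'i. std_normal_distribution" by (rule product_sigma_finite_std_normal)
  interpret P: pair_sigma_finite ?P lborel
    by (simp add: pair_sigma_finite_def sigma_finite assms(1) sigma_finite_lborel)
  have eq: "ennreal (normal_density (\<Sum>j\<in>J. x j * \<beta> j) ?s y * normal_density (\<Sum>j\<in>J. x j * \<beta>' j) ?s y
                / std_normal_density y)
      = ennreal (normal_density 0 ?s (y - (\<Sum>j\<in>J. x j * \<beta> j)) * normal_density 0 ?s (y - (\<Sum>j\<in>J. x j * \<beta>' j)))
        * ennreal (1 / std_normal_density y)" for x y
    by (simp add: normal_density_def ennreal_mult' [symmetric])
  \<comment> \<open>With \<open>y\<close> outermost, the inner integral over the row is covered by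
    \<open>nn_integral_linear_form_diagonal\<close>.\<close>
  have "(\<integral>\<^sup>+ x. (\<integral>\<^sup>+ y. ennreal (normal_density (\<Sum>j\<in>J. x j * \<beta> j) ?s y
                * normal_density (\<Sum>j\<in>J. x j * \<beta>' j) ?s y / std_normal_density y) \<partial>lborel) \<partial>?P)
     = (\<integral>\<^sup>+ y. (\<integral>\<^sup>+ x. ennreal (normal_density 0 ?s (y - (\<Sum>j\<in>J. x j * \<beta> j))
                * normal_density 0 ?s (y - (\<Sum>j\<in>J. x j * \<beta>' j))) * ennreal (1 / std_normal_density y) \<partial>?P) \<partial>lborel)"
    unfolding eq by (rule P.Fubini' [symmetric]) measurable
  also have "\<dots> = (\<integral>\<^sup>+ y. ennreal (normal_density 0 \<rho> y / (2 * \<tau> * sqrt pi)) * ennreal (1 / std_normal_density y) \<partial>lborel)"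
  proof (intro nn_integral_cong, subst nn_integral_multc)
    fix y :: real
    have "\<tau>\<^sup>2 / 2 + (\<Sum>j\<in>A. (\<beta> j)\<^sup>2) = (1 + r) / 2"
      unfolding \<tau>(2) rA(1) [symmetric] by (simp add: field_simps)
    then have "\<rho> = sqrt (\<tau>\<^sup>2 / 2 + (\<Sum>j\<in>A. (\<beta> j)\<^sup>2))"
      by (simp add: \<rho>_def)
    moreover have "(\<integral>\<^sup>+ x. ennreal (normal_density 0 ?s (y - (\<Sum>j\<in>J. x j * \<beta> j))
                * normal_density 0 ?s (y - (\<Sum>j\<in>J. x j * \<beta>' j))) \<partial>?P)
       = ennreal (normal_density 0 (sqrt (\<tau>\<^sup>2 / 2 + (\<Sum>j\<in>A. (\<beta> j)\<^sup>2))) y / (2 * \<tau> * sqrt pi))"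
      unfolding J
      by (intro nn_integral_linear_form_diagonal fin AB s(1) \<tau>(1)) (use s(2) \<tau>(2) sB in auto)
    ultimately show "(\<integral>\<^sup>+ x. ennreal (normal_density 0 ?s (y - (\<Sum>j\<in>J. x j * \<beta> j))
                * normal_density 0 ?s (y - (\<Sum>j\<in>J. x j * \<beta>' j))) \<partial>?P) * ennreal (1 / std_normal_density y)
      = ennreal (normal_density 0 \<rho> y / (2 * \<tau> * sqrt pi)) * ennreal (1 / std_normal_density y)"
      by simp
  qed measurable
  also have "\<dots> = (\<integral>\<^sup>+ y. ennreal (1 / (2 * \<tau> * sqrt pi)) * ennreal (normal_density 0 \<rho> y / std_normal_density y) \<partial>lborel)"
    using \<tau>(1) by (intro nn_integral_cong) (simp add: ennreal_mult' [symmetric])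
  also have "\<dots> = ennreal (1 / (2 * \<tau> * sqrt pi)) * ennreal (sqrt (2 * pi) / sqrt (1 - \<rho>\<^sup>2))"
    by (subst nn_integral_cmult) (simp_all add: nn_integral_normal_density_ratio[OF \<rho>(1,2)])
  also have "\<dots> = ennreal (1 / (1 - r))"
  proof -
    have "1 - \<rho>\<^sup>2 = (1 - r) / 2"
      using \<rho>(3) by (simp add: field_simps)
    then have "sqrt (1 - \<rho>\<^sup>2) = sqrt ((1 - r) / 2)"
      by (rule arg_cong)
    then have "sqrt (1 - \<rho>\<^sup>2) = \<tau> / sqrt 2"
      by (simp add: \<tau>_def real_sqrt_divide)
    then have "sqrt (2 * pi) / sqrt (1 - \<rho>\<^sup>2) = 2 * sqrt pi / \<tau>"
      by (simp add: real_sqrt_mult)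
    then have "1 / (2 * \<tau> * sqrt pi) * (sqrt (2 * pi) / sqrt (1 - \<rho>\<^sup>2)) = 1 / \<tau>\<^sup>2"
      by (simp add: power2_eq_square)
    then show ?thesis
      using \<tau> by (simp add: ennreal_mult' [symmetric])
  qed
  finally show ?thesis
    by (simp add: r_def)
qed

section \<open>Lower bounds by comparison of two hypotheses\<close>

text \<open>Write \<open>d\<close> for the distance of \<open>a\<close> and \<open>b\<close>. By the
  triangle inequality \<open>d\<close> is at most the mean of \<open>L * \<bar>g - b\<bar>\<close>
  plus that of \<open>L * \<bar>g - a\<bar>\<close>. The first is controlled by the risk under the
  alternative with density \<open>L\<close>, the second by the risk under \<open>P\<close> and the
  second moment of \<open>L\<close>.\<close>

lemma two_point_lower_bound:
  fixes L g :: "'a \<Rightarrow> real" and R :: ennreal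
  assumes [measurable]: "L \<in> borel_measurable P" "g \<in> borel_measurable P"
    and L: "\<And>x. 0 \<le> L x" "(\<integral>\<^sup>+ x. ennreal (L x) \<partial>P) = 1"
    and M: "(\<integral>\<^sup>+ x. ennreal ((L x)\<^sup>2) \<partial>P) \<le> ennreal M" "0 \<le> M"
    and R: "(\<integral>\<^sup>+ x. ennreal ((g x - a)\<^sup>2) \<partial>P) \<le> R" "(\<integral>\<^sup>+ x. ennreal (L x * (g x - b)\<^sup>2) \<partial>P) \<le> R"
  shows "ennreal ((b - a)\<^sup>2 / (2 * (1 + M))) \<le> R"
proof (cases "R = \<top> \<or> a = b")
  case True
  then show ?thesis by auto
next
  case False
  then obtain r where r: "R = ennreal r" "0 \<le> r"
    by (cases R) auto
  define d where "d = \<bar>b - a\<bar>"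
  \<comment> \<open>This weight optimises the final bound: \<open>(1 + M) / (2 * t)\<close> becomes
    \<open>d / 2\<close>, and the other half of \<open>d\<close> is left for
    \<open>t * r\<close>.\<close>
  define t where "t = (1 + M) / d"
  have d: "d > 0" and t: "t > 0"
    using False M(2) by (auto simp: d_def t_def)
  \<comment> \<open>AM-GM replaces the Cauchy-Schwarz inequality, so that everything can be integrated pointwise.\<close>
  have young: "u * v \<le> t / 2 * u\<^sup>2 + v\<^sup>2 / (2 * t)" for u v :: real
  proof -
    have "0 \<le> (t * u - v)\<^sup>2 / (2 * t)" using t by simp
    also have "\<dots> = t / 2 * u\<^sup>2 + v\<^sup>2 / (2 * t) - u * v"
      using t by (simp add: power2_eq_square field_simps)
    finally show ?thesis by simp
  qed
  have pointwise: "d * L x \<le> t / 2 * (L x * (g x - b)\<^sup>2) + L x / (2 * t) + t / 2 * (g x - a)\<^sup>2 + (L x)\<^sup>2 / (2 * t)" for x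
  proof -
    have "d * L x \<le> (\<bar>g x - b\<bar> + \<bar>g x - a\<bar>) * L x"
      using L(1) by (intro mult_right_mono) (auto simp: d_def)
    moreover have "\<bar>g x - b\<bar> * 1 * L x \<le> (t / 2 * (g x - b)\<^sup>2 + 1 / (2 * t)) * L x"
      using young[of "\<bar>g x - b\<bar>" 1] L(1) by (intro mult_right_mono) auto
    moreover have "\<bar>g x - a\<bar> * L x \<le> t / 2 * (g x - a)\<^sup>2 + (L x)\<^sup>2 / (2 * t)"
      using young[of "\<bar>g x - a\<bar>" "L x"] by simp
    ultimately show ?thesis by (simp add: algebra_simps)
  qed
  have "ennreal d = (\<integral>\<^sup>+ x. ennreal (d * L x) \<partial>P)"
    using L d by (simp add: ennreal_mult' nn_integral_cmult)
  also have "\<dots> \<le> (\<integral>\<^sup>+ x. ennreal (t / 2) * ennreal (L x * (g x - b)\<^sup>2) + ennreal (1 / (2 * t)) * ennreal (L x)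
      + ennreal (t / 2) * ennreal ((g x - a)\<^sup>2) + ennreal (1 / (2 * t)) * ennreal ((L x)\<^sup>2) \<partial>P)"
    using pointwise t L(1)
    by (intro nn_integral_mono)
       (simp add: ennreal_mult' [symmetric] ennreal_plus [symmetric] del: ennreal_plus)
  also have "\<dots> = ennreal (t / 2) * (\<integral>\<^sup>+ x. ennreal (L x * (g x - b)\<^sup>2) \<partial>P) + ennreal (1 / (2 * t))
      + ennreal (t / 2) * (\<integral>\<^sup>+ x. ennreal ((g x - a)\<^sup>2) \<partial>P)
      + ennreal (1 / (2 * t)) * (\<integral>\<^sup>+ x. ennreal ((L x)\<^sup>2) \<partial>P)"
    by (simp add: nn_integral_add nn_integral_cmult L(2))
  also have "\<dots> \<le> ennreal (t / 2) * ennreal r + ennreal (1 / (2 * t)) + ennreal (t / 2) * ennreal r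
      + ennreal (1 / (2 * t)) * ennreal M"
    using R M(1) unfolding r(1) by (intro add_mono mult_left_mono) auto
  also have "\<dots> = ennreal (t * r + (1 + M) / (2 * t))"
    using t r(2) M(2)
    by (simp add: ennreal_mult' [symmetric] ennreal_plus [symmetric] add_divide_distrib del: ennreal_plus)
  finally have "d \<le> t * r + (1 + M) / (2 * t)"
    using t r(2) M(2) by (subst (asm) ennreal_le_iff) auto
  moreover have "(1 + M) / (2 * t) = d / 2"
    using M(2) d by (simp add: t_def field_simps)
  ultimately have "d / 2 \<le> (1 + M) / d * r"
    unfolding t_def by linarith
  then have "d\<^sup>2 / (2 * (1 + M)) \<le> r"
    using d M(2) by (simp add: field_simps power2_eq_square)
  then show ?thesis
    by (simp add: r d_def ennreal_leI)
qed

section \<open>Change of measure for Gaussian vectors\<close>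

text \<open>Both sides integrate \<open>h\<close> against the product of the laws with means
  \<open>\<mu> i\<close> and standard deviation \<open>\<sigma>\<close>: on the left as the image of
  centred noise under a translation, on the right through its density with respect to the standard
  Gaussian.\<close>

lemma nn_integral_gaussian_vector_shift:
  assumes "\<sigma> > 0" and h: "h \<in> borel_measurable (PiM {..<m} (\<lambda>_. borel))"
  shows "(\<integral>\<^sup>+ \<epsilon>. h (\<lambda>i\<in>{..<m}. \<mu> i + \<epsilon> i) \<partial>gaussian_vector m \<sigma>)
       = (\<integral>\<^sup>+ y. ennreal (\<Prod>i<m. normal_density (\<mu> i) \<sigma> (y i) / std_normal_density (y i)) * h y
            \<partial>gaussian_vector m 1)"
proof -
  let ?Q = "\<lambda>i. density lborel (normal_density (\<mu> i) \<sigma>)"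
  let ?B = "PiM {..<m} (\<lambda>_. borel :: real measure)"
  let ?T = "\<lambda>\<epsilon>::nat \<Rightarrow> real. \<lambda>i\<in>{..<m}. \<mu> i + \<epsilon> i"
  let ?w = "\<lambda>i y. normal_density (\<mu> i) \<sigma> y / std_normal_density y"
  interpret Q: product_sigma_finite ?Q
    using product_sigma_finite_normal[of "\<lambda>_. \<sigma>" \<mu>] assms(1) by simp
  note [measurable_cong] = sets_gaussian_vector
  have T[measurable]: "?T \<in> measurable (gaussian_vector m \<sigma>) ?B"
    by measurable
  have setsQ: "sets (PiM {..<m} ?Q) = sets ?B"
    by (intro sets_PiM_cong) auto
  have "distr (gaussian_vector m \<sigma>) ?B ?T = PiM {..<m} ?Q"
  proof (rule Q.PiM_eqI)
    fix A assume A: "\<And>i. i \<in> {..<m} \<Longrightarrow> A i \<in> sets (?Q i)"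
    then have [measurable]: "\<And>i. i \<in> {..<m} \<Longrightarrow> A i \<in> sets borel" by simp
    have [measurable]: "Pi\<^sub>E {..<m} A \<in> sets ?B"
      by (intro sets_PiM_I_finite) auto
    have "emeasure (distr (gaussian_vector m \<sigma>) ?B ?T) (Pi\<^sub>E {..<m} A)
        = (\<integral>\<^sup>+ x. indicator (Pi\<^sub>E {..<m} A) x \<partial>distr (gaussian_vector m \<sigma>) ?B ?T)"
      by simp
    also have "\<dots> = (\<integral>\<^sup>+ \<epsilon>. indicator (Pi\<^sub>E {..<m} A) (?T \<epsilon>) \<partial>gaussian_vector m \<sigma>)"
      by (rule nn_integral_distr) measurable
    also have "\<dots> = (\<integral>\<^sup>+ \<epsilon>. (\<Prod>i<m. indicator (A i) (\<mu> i + \<epsilon> i)) \<partial>gaussian_vector m \<sigma>)"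
      by (intro nn_integral_cong) (auto simp: indicator_def PiE_iff prod_zero_iff)
    also have "\<dots> = (\<Prod>i<m. \<integral>\<^sup>+ e. indicator (A i) (\<mu> i + e) \<partial>density lborel (normal_density 0 \<sigma>))"
      unfolding gaussian_vector_def
      by (rule product_sigma_finite.product_nn_integral_prod[OF product_sigma_finite_normal]) (use assms(1) in auto)
    also have "\<dots> = (\<Prod>i<m. emeasure (?Q i) (A i))"
    proof (intro prod.cong refl)
      fix i assume i: "i \<in> {..<m}"
      have "emeasure (?Q i) (A i) = (\<integral>\<^sup>+ x. ennreal (normal_density (\<mu> i) \<sigma> x) * indicator (A i) x \<partial>lborel)"
        using i by (subst emeasure_density) auto
      also have "\<dots> = (\<integral>\<^sup>+ e. ennreal (normal_density (\<mu> i) \<sigma> (\<mu> i + e)) * indicator (A i) (\<mu> i + e) \<partial>lborel)"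
        using i by (subst nn_integral_real_affine[where c = 1 and t = "\<mu> i"]) auto
      also have "\<dots> = (\<integral>\<^sup>+ e. indicator (A i) (\<mu> i + e) \<partial>density lborel (normal_density 0 \<sigma>))"
        using i by (subst nn_integral_density) (auto simp: normal_density_def)
      finally show "(\<integral>\<^sup>+ e. indicator (A i) (\<mu> i + e) \<partial>density lborel (normal_density 0 \<sigma>)) = emeasure (?Q i) (A i)" ..
    qed
    finally show "emeasure (distr (gaussian_vector m \<sigma>) ?B ?T) (Pi\<^sub>E {..<m} A) = (\<Prod>i<m. emeasure (?Q i) (A i))" .
  qed (use setsQ in auto)
  moreover have "density (gaussian_vector m 1) (\<lambda>y. ennreal (\<Prod>i<m. ?w i (y i))) = PiM {..<m} ?Q"
  proof (rule Q.PiM_eqI)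
    fix A assume A: "\<And>i. i \<in> {..<m} \<Longrightarrow> A i \<in> sets (?Q i)"
    then have [measurable]: "\<And>i. i \<in> {..<m} \<Longrightarrow> A i \<in> sets borel" by simp
    have [measurable]: "Pi\<^sub>E {..<m} A \<in> sets ?B"
      by (intro sets_PiM_I_finite) auto
    have "emeasure (density (gaussian_vector m 1) (\<lambda>y. ennreal (\<Prod>i<m. ?w i (y i)))) (Pi\<^sub>E {..<m} A)
        = (\<integral>\<^sup>+ y. ennreal (\<Prod>i<m. ?w i (y i)) * indicator (Pi\<^sub>E {..<m} A) y \<partial>gaussian_vector m 1)"
      by (rule emeasure_density) measurable
    also have "\<dots> = (\<integral>\<^sup>+ y. (\<Prod>i<m. ennreal (?w i (y i)) * indicator (A i) (y i)) \<partial>gaussian_vector m 1)"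
    proof (intro nn_integral_cong)
      \<comment> \<open>Points of the space are \<open>undefined\<close> off \<open>{..<m}\<close>,
        so membership in the box depends on the coordinates below \<open>m\<close> only.\<close>
      fix y assume "y \<in> space (gaussian_vector m 1)"
      then have "y \<in> extensional {..<m}"
        by (simp add: gaussian_vector_def space_PiM PiE_def)
      then have "indicator (Pi\<^sub>E {..<m} A) y = (\<Prod>i<m. indicator (A i) (y i) :: ennreal)"
        by (auto simp: indicator_def PiE_iff prod_zero_iff)
      then show "ennreal (\<Prod>i<m. ?w i (y i)) * indicator (Pi\<^sub>E {..<m} A) y
          = (\<Prod>i<m. ennreal (?w i (y i)) * indicator (A i) (y i))"
        by (simp add: prod.distrib prod_ennreal del: prod_dividef)
    qed
    also have "\<dots> = (\<Prod>i<m. \<integral>\<^sup>+ y. ennreal (?w i y) * indicator (A i) y \<partial>std_normal_distribution)"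
      unfolding gaussian_vector_def
      by (rule product_sigma_finite.product_nn_integral_prod[OF product_sigma_finite_std_normal]) auto
    also have "\<dots> = (\<Prod>i<m. emeasure (?Q i) (A i))"
    proof (intro prod.cong refl)
      fix i assume i: "i \<in> {..<m}"
      have "(\<integral>\<^sup>+ y. ennreal (?w i y) * indicator (A i) y \<partial>std_normal_distribution)
          = (\<integral>\<^sup>+ y. ennreal (std_normal_density y) * (ennreal (?w i y) * indicator (A i) y) \<partial>lborel)"
        using i by (subst nn_integral_density) auto
      also have "\<dots> = (\<integral>\<^sup>+ x. ennreal (normal_density (\<mu> i) \<sigma> x) * indicator (A i) x \<partial>lborel)"
        using less_imp_neq[OF normal_density_pos[of 1 0], symmetric]
        by (intro nn_integral_cong) (simp add: mult.assoc [symmetric] ennreal_mult' [symmetric])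
      also have "\<dots> = emeasure (?Q i) (A i)"
        using i by (subst emeasure_density) auto
      finally show "(\<integral>\<^sup>+ y. ennreal (?w i y) * indicator (A i) y \<partial>std_normal_distribution) = emeasure (?Q i) (A i)" .
    qed
    finally show "emeasure (density (gaussian_vector m 1) (\<lambda>y. ennreal (\<Prod>i<m. ?w i (y i)))) (Pi\<^sub>E {..<m} A)
        = (\<Prod>i<m. emeasure (?Q i) (A i))" .
  qed (use setsQ sets_gaussian_vector in auto)
  ultimately have "distr (gaussian_vector m \<sigma>) ?B ?T = density (gaussian_vector m 1) (\<lambda>y. ennreal (\<Prod>i<m. ?w i (y i)))"
    by simp
  then have "(\<integral>\<^sup>+ y. h y \<partial>distr (gaussian_vector m \<sigma>) ?B ?T)
      = (\<integral>\<^sup>+ y. h y \<partial>density (gaussian_vector m 1) (\<lambda>y. ennreal (\<Prod>i<m. ?w i (y i))))"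
    by simp
  moreover have "(\<integral>\<^sup>+ y. h y \<partial>distr (gaussian_vector m \<sigma>) ?B ?T) = (\<integral>\<^sup>+ \<epsilon>. h (?T \<epsilon>) \<partial>gaussian_vector m \<sigma>)"
    using h by (intro nn_integral_distr) auto
  moreover have "(\<integral>\<^sup>+ y. h y \<partial>density (gaussian_vector m 1) (\<lambda>y. ennreal (\<Prod>i<m. ?w i (y i))))
      = (\<integral>\<^sup>+ y. ennreal (\<Prod>i<m. ?w i (y i)) * h y \<partial>gaussian_vector m 1)"
    by (rule nn_integral_density) (use h in measurable)
  ultimately show ?thesis
    by simp
qed

section \<open>Likelihood ratios of the regression model\<close>

lemma prob_space_gaussian_vector: "\<sigma> > 0 \<Longrightarrow> prob_space (gaussian_vector m \<sigma>)"
  unfolding gaussian_vector_def by (intro prob_space_PiM prob_space_normal_density)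

lemma prob_space_gaussian_design: "prob_space (gaussian_design n p)"
  unfolding gaussian_design_def by (intro prob_space_PiM prob_space_gaussian_vector) simp

text \<open>The law of the observations for \<open>\<beta> = 0\<close>, \<open>\<sigma> = 1\<close>, with respect to which likelihood ratios are taken.\<close>

definition null_law :: "nat \<Rightarrow> nat \<Rightarrow> ((nat \<Rightarrow> real) \<times> (nat \<Rightarrow> nat \<Rightarrow> real)) measure" where
  "null_law n p = gaussian_vector n 1 \<Otimes>\<^sub>M gaussian_design n p"

text \<open>For \<open>\<sigma> > 0\<close>, the density of \<open>regression_law\<close> with
  respect to \<open>null_law\<close>. The design has the same law under every hypothesis and
  cancels, so only the responses, independent given \<open>X\<close>, contribute factors.\<close>

definition likelihood_ratio ::
  "nat \<Rightarrow> nat \<Rightarrow> (nat \<Rightarrow> real) \<Rightarrow> real \<Rightarrow> (nat \<Rightarrow> real) \<times> (nat \<Rightarrow> nat \<Rightarrow> real) \<Rightarrow> real" where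
  "likelihood_ratio n p \<beta> \<sigma> = (\<lambda>(y, X).
     \<Prod>i<n. normal_density (\<Sum>j<p. X i j * \<beta> j) \<sigma> (y i) / std_normal_density (y i))"

lemma sets_null_law [measurable_cong]: "sets (null_law n p) = sets (obs_space n p)"
  unfolding null_law_def obs_space_def
  by (intro sets_pair_measure_cong sets_gaussian_vector sets_gaussian_design)

lemma measurable_obs_response:
  "i < n \<Longrightarrow> (\<lambda>\<omega>. fst \<omega> i) \<in> borel_measurable (obs_space n p)"
  unfolding obs_space_def
  by (intro measurable_compose[OF measurable_fst] measurable_component_singleton) simp

lemma measurable_obs_design:
  assumes "i < n" "j < p"
  shows "(\<lambda>\<omega>. snd \<omega> i j) \<in> borel_measurable (obs_space n p)"
proof -
  have "(\<lambda>\<omega>. snd \<omega> i) \<in> measurable (obs_space n p) (PiM {..<p} (\<lambda>_. borel))"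
    using assms unfolding obs_space_def
    by (intro measurable_compose[OF measurable_snd] measurable_component_singleton) simp
  then show ?thesis
    by (rule measurable_compose) (use assms in \<open>intro measurable_component_singleton, simp\<close>)
qed

lemma borel_measurable_normal_density_mean [measurable (raw)]:
  assumes [measurable]: "f \<in> borel_measurable M" "g \<in> borel_measurable M"
  shows "(\<lambda>x. normal_density (f x) \<sigma> (g x)) \<in> borel_measurable M"
  unfolding normal_density_def by measurable

lemma borel_measurable_likelihood_ratio [measurable]:
  "likelihood_ratio n p \<beta> \<sigma> \<in> borel_measurable (obs_space n p)"
  unfolding likelihood_ratio_def split_beta
  by (intro borel_measurable_prod borel_measurable_divide borel_measurable_normal_density_mean
      borel_measurable_sum borel_measurable_times measurable_obs_response measurable_obs_design
      borel_measurable_const) auto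

lemma likelihood_ratio_nonneg: "0 \<le> likelihood_ratio n p \<beta> \<sigma> \<omega>"
  by (auto simp: likelihood_ratio_def split_beta intro!: prod_nonneg)

text \<open>Through this the null hypothesis falls under the same change of measure as the
  alternatives.\<close>

lemma likelihood_ratio_null: "likelihood_ratio n p (\<lambda>j\<in>{..<p}. 0) 1 \<omega> = 1"
  using less_imp_neq[OF normal_density_pos[of 1 0], symmetric]
  by (simp add: likelihood_ratio_def split_beta)

text \<open>The design is outermost to match \<open>nn_integral_regression_law\<close>, so that
  hypotheses can be compared conditionally on the design.\<close>

lemma nn_integral_null_law:
  assumes "h \<in> borel_measurable (obs_space n p)"
  shows "(\<integral>\<^sup>+ \<omega>. h \<omega> \<partial>null_law n p)
       = (\<integral>\<^sup>+ X. (\<integral>\<^sup>+ y. h (y, X) \<partial>gaussian_vector n 1) \<partial>gaussian_design n p)"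
proof -
  interpret pair_prob_space "gaussian_vector n 1" "gaussian_design n p"
    by (simp add: pair_prob_space_def pair_sigma_finite_def prob_space_imp_sigma_finite
        prob_space_gaussian_vector prob_space_gaussian_design)
  have "h \<in> borel_measurable (null_law n p)"
    using assms by (simp add: measurable_cong_sets[OF sets_null_law])
  then show ?thesis
    unfolding null_law_def by (rule nn_integral_snd [symmetric])
qed

lemma nn_integral_regression_law:
  assumes "\<sigma> > 0" and h: "h \<in> borel_measurable (obs_space n p)"
  shows "(\<integral>\<^sup>+ \<omega>. h \<omega> \<partial>regression_law n p \<beta> \<sigma>)
       = (\<integral>\<^sup>+ X. (\<integral>\<^sup>+ \<epsilon>. h (response n p \<beta> X \<epsilon>, X) \<partial>gaussian_vector n \<sigma>) \<partial>gaussian_design n p)"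
proof -
  interpret pair_prob_space "gaussian_design n p" "gaussian_vector n \<sigma>"
    using assms(1) by (simp add: pair_prob_space_def pair_sigma_finite_def prob_space_imp_sigma_finite
        prob_space_gaussian_vector prob_space_gaussian_design)
  have "(\<lambda>\<omega>. h (case \<omega> of (X, \<epsilon>) \<Rightarrow> (response n p \<beta> X \<epsilon>, X)))
      \<in> borel_measurable (gaussian_design n p \<Otimes>\<^sub>M gaussian_vector n \<sigma>)"
    by (rule measurable_compose[OF regression_map_measurable h])
  then show ?thesis
    unfolding regression_law_def
    by (subst nn_integral_distr[OF regression_map_measurable])
       (simp_all add: h M2.nn_integral_fst [symmetric])
qed

text \<open>For a fixed design the response is noise translated by the linear predictors, so
  \<open>nn_integral_gaussian_vector_shift\<close> applies inside the integral over
  \<open>X\<close>.\<close>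

lemma nn_integral_regression_law_likelihood_ratio:
  assumes "\<sigma> > 0" and [measurable]: "h \<in> borel_measurable (obs_space n p)"
  shows "(\<integral>\<^sup>+ \<omega>. h \<omega> \<partial>regression_law n p \<beta> \<sigma>)
       = (\<integral>\<^sup>+ \<omega>. ennreal (likelihood_ratio n p \<beta> \<sigma> \<omega>) * h \<omega> \<partial>null_law n p)"
proof -
  have "(\<integral>\<^sup>+ \<epsilon>. h (response n p \<beta> X \<epsilon>, X) \<partial>gaussian_vector n \<sigma>)
      = (\<integral>\<^sup>+ y. ennreal (likelihood_ratio n p \<beta> \<sigma> (y, X)) * h (y, X) \<partial>gaussian_vector n 1)"
    if "X \<in> space (gaussian_design n p)" for X
  proof -
    have "X \<in> space (PiM {..<n} (\<lambda>_. PiM {..<p} (\<lambda>_. borel)))"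
      using that by (simp add: sets_eq_imp_space_eq[OF sets_gaussian_design])
    then have "(\<lambda>y. h (y, X)) \<in> borel_measurable (PiM {..<n} (\<lambda>_. borel))"
      using assms(2) unfolding obs_space_def by (intro measurable_Pair1)
    then show ?thesis
      using nn_integral_gaussian_vector_shift[OF assms(1), of "\<lambda>y. h (y, X)" n "\<lambda>i. \<Sum>j<p. X i j * \<beta> j"]
      by (simp add: response_def likelihood_ratio_def)
  qed
  then show ?thesis
    by (subst nn_integral_null_law, measurable)
       (simp add: nn_integral_regression_law[OF assms] cong: nn_integral_cong)
qed

text \<open>Both ratios are products over rows, and the rows are independent under
  \<open>null_law\<close>; hence the \<open>n\<close>-th power of the integral in
  \<open>row_second_moment\<close>.\<close>

lemma likelihood_ratio_second_moment:
  assumes "\<And>j. j < p \<Longrightarrow> \<beta> j * \<beta>' j = 0 \<or> \<beta> j = \<beta>' j"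
    and "(\<Sum>j<p. (\<beta> j)\<^sup>2) = \<theta>" "(\<Sum>j<p. (\<beta>' j)\<^sup>2) = \<theta>" "\<theta> < 1"
  shows "(\<integral>\<^sup>+ \<omega>. ennreal (likelihood_ratio n p \<beta> (sqrt (1 - \<theta>)) \<omega>
              * likelihood_ratio n p \<beta>' (sqrt (1 - \<theta>)) \<omega>) \<partial>null_law n p)
       = ennreal (1 / (1 - (\<Sum>j<p. \<beta> j * \<beta>' j)) ^ n)"
proof -
  let ?s = "sqrt (1 - \<theta>)"
  let ?f = "\<lambda>(x::nat \<Rightarrow> real) y. normal_density (\<Sum>j<p. x j * \<beta> j) ?s y / std_normal_density y
              * (normal_density (\<Sum>j<p. x j * \<beta>' j) ?s y / std_normal_density y)"
  let ?r = "\<Sum>j<p. \<beta> j * \<beta>' j"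
  note [measurable_cong] = sets_gaussian_vector
  interpret product_sigma_finite "\<lambda>_::nat. std_normal_distribution" by (rule product_sigma_finite_std_normal)
  interpret G: product_sigma_finite "\<lambda>_::nat. gaussian_vector p 1"
    by (simp add: product_sigma_finite_def prob_space_imp_sigma_finite prob_space_gaussian_vector)
  have "?r \<le> \<theta>"
  proof -
    have "?r \<le> (\<Sum>j<p. (\<beta> j)\<^sup>2)"
      by (intro sum_mono) (use assms(1) in \<open>force simp: power2_eq_square\<close>)
    then show ?thesis using assms(2) by simp
  qed
  then have r: "?r < 1" using assms(4) by simp
  have row: "(\<integral>\<^sup>+ x. (\<integral>\<^sup>+ y. ennreal (?f x y) \<partial>std_normal_distribution) \<partial>gaussian_vector p 1) = ennreal (1 / (1 - ?r))"
  proof -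
    \<comment> \<open>One of the two standard densities in the denominator cancels against that of
      the integrating measure.\<close>
    have "(\<integral>\<^sup>+ y. ennreal (?f x y) \<partial>std_normal_distribution)
        = (\<integral>\<^sup>+ y. ennreal (normal_density (\<Sum>j<p. x j * \<beta> j) ?s y
              * normal_density (\<Sum>j<p. x j * \<beta>' j) ?s y / std_normal_density y) \<partial>lborel)" for x :: "nat \<Rightarrow> real"
      using less_imp_neq[OF normal_density_pos[of 1 0], symmetric]
      by (subst nn_integral_density) (auto simp: ennreal_mult' [symmetric] intro!: nn_integral_cong)
    then show ?thesis
      using row_second_moment[of "{..<p}" \<beta> \<beta>' \<theta>] assms by (simp add: gaussian_vector_def)
  qed
  have "(\<integral>\<^sup>+ \<omega>. ennreal (likelihood_ratio n p \<beta> ?s \<omega> * likelihood_ratio n p \<beta>' ?s \<omega>) \<partial>null_law n p)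
      = (\<integral>\<^sup>+ X. (\<integral>\<^sup>+ y. (\<Prod>i<n. ennreal (?f (X i) (y i))) \<partial>gaussian_vector n 1) \<partial>gaussian_design n p)"
    by (subst nn_integral_null_law, measurable)
       (simp add: likelihood_ratio_def prod.distrib [symmetric] prod_ennreal del: prod_dividef)
  also have "\<dots> = (\<integral>\<^sup>+ X. (\<Prod>i<n. \<integral>\<^sup>+ y. ennreal (?f (X i) y) \<partial>std_normal_distribution) \<partial>gaussian_design n p)"
    unfolding gaussian_vector_def[of n] by (intro nn_integral_cong product_nn_integral_prod) measurable
  also have "\<dots> = (\<Prod>i<n. \<integral>\<^sup>+ x. (\<integral>\<^sup>+ y. ennreal (?f x y) \<partial>std_normal_distribution) \<partial>gaussian_vector p 1)"
    unfolding gaussian_design_def by (rule G.product_nn_integral_prod) measurable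
  also have "\<dots> = ennreal (1 / (1 - ?r) ^ n)"
    using r unfolding row by (simp add: ennreal_power power_one_over)
  finally show ?thesis .
qed

section \<open>Risk bounds from finite priors\<close>

lemma risk_le_max_risk:
  assumes "\<beta> \<in> sparse_vectors p k" "\<sigma> > 0"
  shows "(\<integral>\<^sup>+ \<omega>. ennreal ((\<eta>' \<omega> - explained_variance p \<beta> \<sigma>)\<^sup>2) \<partial>regression_law n p \<beta> \<sigma>) \<le> max_risk n p k \<eta>'"
  unfolding max_risk_def using assms by (intro SUP_upper2[of \<beta>] SUP_upper2[of \<sigma>]) auto

text \<open>The maximal risk dominates the average risk under the uniform prior on \<open>F\<close>.
  Noise variance \<open>1 - \<theta>\<close> gives every \<open>b f\<close> the explained variance
  \<open>\<theta>\<close>, so the mixture acts as a single alternative at distance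
  \<open>\<theta>\<close> from the null value 0. The double sum is the second moment of its
  likelihood ratio, up to normalisation.\<close>

lemma max_risk_ge_mixture:
  fixes b :: "'f \<Rightarrow> nat \<Rightarrow> real" and M :: real
  assumes F: "finite F" "F \<noteq> {}"
    and b: "\<And>f. f \<in> F \<Longrightarrow> b f \<in> sparse_vectors p k" "\<And>f. f \<in> F \<Longrightarrow> (\<Sum>j<p. (b f j)\<^sup>2) = \<theta>"
      "\<And>f g j. f \<in> F \<Longrightarrow> g \<in> F \<Longrightarrow> j < p \<Longrightarrow> b f j * b g j = 0 \<or> b f j = b g j"
    and \<theta>: "\<theta> < 1" and "0 \<le> M"
    and M: "(\<Sum>f\<in>F. \<Sum>g\<in>F. 1 / (1 - (\<Sum>j<p. b f j * b g j)) ^ n) \<le> M * (card F)\<^sup>2"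
    and [measurable]: "\<eta>' \<in> borel_measurable (obs_space n p)"
  shows "ennreal (\<theta>\<^sup>2 / (2 * (1 + M))) \<le> max_risk n p k \<eta>'"
proof -
  let ?s = "sqrt (1 - \<theta>)" and ?N = "real (card F)"
  define l where "l f = likelihood_ratio n p (b f) ?s" for f
  define L where "L \<omega> = (\<Sum>f\<in>F. l f \<omega>) / ?N" for \<omega>
  have N: "?N > 0" using F by (simp add: card_gt_0_iff)
  have s: "?s > 0" using \<theta> by simp
  have l[measurable]: "l f \<in> borel_measurable (obs_space n p)" "l f \<in> borel_measurable (null_law n p)" for f
    unfolding l_def by measurable
  have l0: "0 \<le> l f \<omega>" for f \<omega>
    by (simp add: l_def likelihood_ratio_nonneg)
  \<comment> \<open>A bound common to all alternatives passes to their mixture; \<open>K\<close> may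
    be infinite, as the maximal risk may be.\<close>
  have avg: "(\<integral>\<^sup>+ \<omega>. ennreal (L \<omega> * h \<omega>) \<partial>null_law n p) \<le> K"
    if [measurable]: "h \<in> borel_measurable (obs_space n p)" and h: "\<And>\<omega>. 0 \<le> h \<omega>"
      and K: "\<And>f. f \<in> F \<Longrightarrow> (\<integral>\<^sup>+ \<omega>. ennreal (l f \<omega>) * ennreal (h \<omega>) \<partial>null_law n p) \<le> K" for h K
  proof -
    have "(\<integral>\<^sup>+ \<omega>. ennreal (L \<omega> * h \<omega>) \<partial>null_law n p)
        = (\<integral>\<^sup>+ \<omega>. ennreal (1 / ?N) * (\<Sum>f\<in>F. ennreal (l f \<omega>) * ennreal (h \<omega>)) \<partial>null_law n p)"
      using N h l0
      by (intro nn_integral_cong)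
         (simp add: L_def sum_ennreal sum_nonneg ennreal_mult' [symmetric] sum_distrib_right [symmetric])
    also have "\<dots> = ennreal (1 / ?N) * (\<Sum>f\<in>F. \<integral>\<^sup>+ \<omega>. ennreal (l f \<omega>) * ennreal (h \<omega>) \<partial>null_law n p)"
      by (simp add: nn_integral_cmult nn_integral_sum)
    also have "\<dots> \<le> ennreal (1 / ?N) * (\<Sum>f\<in>F. K)"
      by (intro mult_left_mono sum_mono K) auto
    also have "\<dots> = (ennreal (1 / ?N) * ennreal ?N) * K"
      by (simp add: mult.assoc ennreal_of_nat_eq_real_of_nat)
    also have "\<dots> = ennreal (1 / ?N * ?N) * K"
      by (subst ennreal_mult') auto
    also have "\<dots> = K" using N by simp
    finally show ?thesis .
  qed
  have lint: "(\<integral>\<^sup>+ \<omega>. ennreal (l f \<omega>) \<partial>null_law n p) = 1" for f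
    using nn_integral_regression_law_likelihood_ratio[OF s, of "\<lambda>_. 1" n p "b f"]
      prob_space.emeasure_space_1[OF prob_space_regression_law[OF s]]
    by (simp add: l_def)
  have ev: "explained_variance p (b f) ?s = \<theta>" if "f \<in> F" for f
    using b(2)[OF that] \<theta> by (simp add: explained_variance_def)
  have "ennreal ((\<theta> - 0)\<^sup>2 / (2 * (1 + M))) \<le> max_risk n p k \<eta>'"
  proof (rule two_point_lower_bound[where P = "null_law n p" and L = L and g = \<eta>'])
    show "L \<in> borel_measurable (null_law n p)" "\<eta>' \<in> borel_measurable (null_law n p)"
      unfolding L_def by measurable
    show "0 \<le> L \<omega>" for \<omega>
      using l0 by (simp add: L_def sum_nonneg)
    have "(\<integral>\<^sup>+ \<omega>. ennreal (L \<omega>) \<partial>null_law n p) 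
        = (\<integral>\<^sup>+ \<omega>. ennreal (1 / ?N) * (\<Sum>f\<in>F. ennreal (l f \<omega>)) \<partial>null_law n p)"
      using N l0
      by (intro nn_integral_cong) (simp add: L_def sum_ennreal sum_nonneg ennreal_mult' [symmetric])
    also have "\<dots> = ennreal (1 / ?N) * ennreal ?N"
      by (simp add: nn_integral_cmult nn_integral_sum lint ennreal_of_nat_eq_real_of_nat)
    also have "\<dots> = 1"
      using N by (simp add: ennreal_mult' [symmetric])
    finally show "(\<integral>\<^sup>+ \<omega>. ennreal (L \<omega>) \<partial>null_law n p) = 1" .
    show "(\<integral>\<^sup>+ \<omega>. ennreal (L \<omega> * (\<eta>' \<omega> - \<theta>)\<^sup>2) \<partial>null_law n p) \<le> max_risk n p k \<eta>'"
    proof (rule avg)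
      fix f assume f: "f \<in> F"
      show "(\<integral>\<^sup>+ \<omega>. ennreal (l f \<omega>) * ennreal ((\<eta>' \<omega> - \<theta>)\<^sup>2) \<partial>null_law n p) \<le> max_risk n p k \<eta>'"
        using risk_le_max_risk[OF b(1)[OF f] s, of n \<eta>']
        by (simp add: l_def ev[OF f] nn_integral_regression_law_likelihood_ratio[OF s])
    qed auto
    have zero: "(\<lambda>j\<in>{..<p}. 0) \<in> sparse_vectors p k"
      by (auto simp: sparse_vectors_def)
    have "explained_variance p (\<lambda>j\<in>{..<p}. 0) 1 = 0"
      by (simp add: explained_variance_def)
    then show "(\<integral>\<^sup>+ \<omega>. ennreal ((\<eta>' \<omega> - 0)\<^sup>2) \<partial>null_law n p) \<le> max_risk n p k \<eta>'"
      using risk_le_max_risk[OF zero, of 1 n \<eta>']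
      by (simp add: nn_integral_regression_law_likelihood_ratio likelihood_ratio_null)
    have "(\<integral>\<^sup>+ \<omega>. ennreal ((L \<omega>)\<^sup>2) \<partial>null_law n p)
        = (\<integral>\<^sup>+ \<omega>. ennreal (1 / ?N\<^sup>2) * (\<Sum>f\<in>F. \<Sum>g\<in>F. ennreal (l f \<omega> * l g \<omega>)) \<partial>null_law n p)"
      using N l0
      by (intro nn_integral_cong)
         (simp add: L_def sum_ennreal sum_nonneg ennreal_mult' [symmetric] power_divide
           power2_eq_square[of "sum _ _"] sum_product)
    also have "\<dots> = ennreal (1 / ?N\<^sup>2) * (\<Sum>f\<in>F. \<Sum>g\<in>F. \<integral>\<^sup>+ \<omega>. ennreal (l f \<omega> * l g \<omega>) \<partial>null_law n p)"
      by (simp add: nn_integral_cmult nn_integral_sum)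
    also have "\<dots> = ennreal (1 / ?N\<^sup>2) * (\<Sum>f\<in>F. \<Sum>g\<in>F. ennreal (1 / (1 - (\<Sum>j<p. b f j * b g j)) ^ n))"
      using b \<theta> unfolding l_def
      by (intro arg_cong2[where f = "(*)"] refl sum.cong likelihood_ratio_second_moment) auto
    also have "\<dots> = ennreal (1 / ?N\<^sup>2 * (\<Sum>f\<in>F. \<Sum>g\<in>F. 1 / (1 - (\<Sum>j<p. b f j * b g j)) ^ n))"
    proof -
      \<comment> \<open>Since \<open>ennreal\<close> truncates negative reals, it is pulled out of
        the sums only once the denominators are known to be nonnegative.\<close>
      have "(\<Sum>j<p. b f j * b g j) \<le> (\<Sum>j<p. (b f j)\<^sup>2)" if "f \<in> F" "g \<in> F" for f g
        by (intro sum_mono) (use b(3) that in \<open>force simp: power2_eq_square\<close>)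
      then have "0 \<le> 1 - (\<Sum>j<p. b f j * b g j)" if "f \<in> F" "g \<in> F" for f g
        using b(2) \<theta> that by fastforce
      then show ?thesis
        by (simp add: sum_ennreal sum_nonneg ennreal_mult' [symmetric])
    qed
    also have "\<dots> \<le> ennreal M"
      using M N by (intro ennreal_leI) (simp add: field_simps)
    finally show "(\<integral>\<^sup>+ \<omega>. ennreal ((L \<omega>)\<^sup>2) \<partial>null_law n p) \<le> ennreal M" .
  qed fact
  then show ?thesis by simp
qed

section \<open>The parametric rate\<close>

text \<open>Squaring halves the variance, so the integrand is a multiple of the density ratio for
  standard deviation \<open>\<sigma> / sqrt 2\<close>, which is below 1 as
  \<open>\<sigma>\<^sup>2 < 2\<close>.\<close>

lemma normal_density_chi_square:
  assumes "0 < \<sigma>" "\<sigma>\<^sup>2 < 2"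
  shows "(\<integral>\<^sup>+ y. ennreal ((normal_density 0 \<sigma> y / std_normal_density y)\<^sup>2) \<partial>std_normal_distribution)
       = ennreal (1 / (\<sigma> * sqrt (2 - \<sigma>\<^sup>2)))"
proof -
  let ?\<rho> = "\<sigma> / sqrt 2"
  have "\<sigma> < sqrt 2"
    using assms(2) by (simp add: real_less_rsqrt)
  then have \<rho>: "0 < ?\<rho>" "?\<rho> < 1"
    using assms(1) by simp_all
  have "(\<integral>\<^sup>+ y. ennreal ((normal_density 0 \<sigma> y / std_normal_density y)\<^sup>2) \<partial>std_normal_distribution)
      = (\<integral>\<^sup>+ y. ennreal (1 / (2 * \<sigma> * sqrt pi)) * ennreal (normal_density 0 ?\<rho> y / std_normal_density y) \<partial>lborel)"
    using less_imp_neq[OF normal_density_pos[of 1 0], symmetric] assms(1)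
    by (subst nn_integral_density)
       (auto simp: ennreal_mult' [symmetric] power_divide normal_density_power2[OF assms(1)]
         power2_eq_square[of "std_normal_density _"] intro!: nn_integral_cong)
  also have "\<dots> = ennreal (1 / (2 * \<sigma> * sqrt pi)) * ennreal (sqrt (2 * pi) / sqrt (1 - ?\<rho>\<^sup>2))"
    by (simp add: nn_integral_cmult nn_integral_normal_density_ratio[OF \<rho>])
  also have "\<dots> = ennreal (1 / (\<sigma> * sqrt (2 - \<sigma>\<^sup>2)))"
  proof -
    have "1 - ?\<rho>\<^sup>2 = (2 - \<sigma>\<^sup>2) / 2"
      by (simp add: power_divide field_simps)
    then have "sqrt (1 - ?\<rho>\<^sup>2) = sqrt ((2 - \<sigma>\<^sup>2) / 2)"
      by (rule arg_cong)
    then have "sqrt (2 * pi) / sqrt (1 - ?\<rho>\<^sup>2) = 2 * sqrt pi / sqrt (2 - \<sigma>\<^sup>2)"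
      by (simp add: real_sqrt_mult real_sqrt_divide)
    then show ?thesis
      using assms by (simp add: ennreal_mult' [symmetric])
  qed
  finally show ?thesis .
qed

text \<open>Both hypotheses share \<open>\<beta>\<close>, so they are compared on the space of
  design and noise: the observation is the same function of \<open>(X, \<epsilon>)\<close>, and only
  the law of \<open>\<epsilon>\<close> changes. A separation of at least \<open>\<delta> / 4\<close>
  and a second moment of at most 2 give
  \<open>(\<delta> / 4)\<^sup>2 / 6 = 1 / (384 * n)\<close>.\<close>

lemma max_risk_ge_parametric:
  assumes n: "n \<ge> 1" and p: "p \<ge> 1" and k: "k \<ge> 1"
    and \<eta>'[measurable]: "\<eta>' \<in> borel_measurable (obs_space n p)"
  shows "ennreal (1 / (384 * real n)) \<le> max_risk n p k \<eta>'"
proof -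
  \<comment> \<open>Chosen so that \<open>n * \<delta>\<^sup>2 = 1 / 4\<close>, which keeps the
    second moment, the \<open>n\<close>-th power of \<open>1 / sqrt (1 - \<delta>\<^sup>2)\<close>,
    bounded.\<close>
  define \<delta> where "\<delta> = 1 / (2 * sqrt (real n))"
  define \<sigma> where "\<sigma> = sqrt (1 - \<delta>)"
  define \<beta> where "\<beta> = (\<lambda>j\<in>{..<p}. if j = 0 then 1 else 0 :: real)"
  have \<delta>: "0 < \<delta>" "\<delta> \<le> 1 / 2" "\<delta>\<^sup>2 = 1 / (4 * real n)"
    using n by (simp_all add: \<delta>_def power_divide power_mult_distrib)
  have \<sigma>: "0 < \<sigma>" "\<sigma>\<^sup>2 = 1 - \<delta>"
    using \<delta> by (simp_all add: \<sigma>_def)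
  have "{j \<in> {..<p}. \<beta> j \<noteq> 0} = {0}"
    using p by (auto simp: \<beta>_def)
  then have sparse: "\<beta> \<in> sparse_vectors p k"
    using k by (auto simp: sparse_vectors_def \<beta>_def)
  have "(\<Sum>j<p. (\<beta> j)\<^sup>2) = (\<Sum>j<p. if j = 0 then 1 else 0)"
    by (intro sum.cong) (auto simp: \<beta>_def)
  then have norm: "(\<Sum>j<p. (\<beta> j)\<^sup>2) = 1"
    using p by simp
  have ev: "explained_variance p \<beta> 1 = 1 / 2" "explained_variance p \<beta> \<sigma> = 1 / (2 - \<delta>)"
    by (simp_all add: explained_variance_def norm \<sigma>(2))
  let ?P = "gaussian_design n p \<Otimes>\<^sub>M gaussian_vector n 1"
  define w where "w \<epsilon> = (\<Prod>i<n. normal_density 0 \<sigma> (\<epsilon> i) / std_normal_density (\<epsilon> i))" for \<epsilon> :: "nat \<Rightarrow> real"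
  define g where "g = (\<lambda>(X, \<epsilon>). \<eta>' (response n p \<beta> X \<epsilon>, X))"
  note [measurable_cong] = sets_gaussian_vector
  have w[measurable]: "w \<in> borel_measurable (gaussian_vector n s)" for s
    unfolding w_def by measurable
  have w0: "0 \<le> w \<epsilon>" for \<epsilon>
    by (auto simp: w_def intro!: prod_nonneg)
  have g: "(\<lambda>(X, \<epsilon>). \<eta>' (response n p \<beta> X \<epsilon>, X)) \<in> borel_measurable ?P"
    using measurable_compose[OF regression_map_measurable \<eta>'] by (simp add: split_beta)
  then have g[measurable]: "g \<in> borel_measurable ?P"
    by (simp add: g_def)
  interpret pair_prob_space "gaussian_design n p" "gaussian_vector n 1"
    by (simp add: pair_prob_space_def pair_sigma_finite_def prob_space_imp_sigma_finite
        prob_space_gaussian_vector prob_space_gaussian_design)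
  have shift: "(\<integral>\<^sup>+ \<epsilon>. h \<epsilon> \<partial>gaussian_vector n \<sigma>) = (\<integral>\<^sup>+ \<epsilon>. ennreal (w \<epsilon>) * h \<epsilon> \<partial>gaussian_vector n 1)"
    if h: "h \<in> borel_measurable (PiM {..<n} (\<lambda>_. borel))" for h
  proof -
    \<comment> \<open>The change of measure is used with mean zero; its restricted function agrees
      with \<open>\<epsilon>\<close> on the space of the measure.\<close>
    have "(\<integral>\<^sup>+ \<epsilon>. h \<epsilon> \<partial>gaussian_vector n \<sigma>) = (\<integral>\<^sup>+ \<epsilon>. h (\<lambda>i\<in>{..<n}. 0 + \<epsilon> i) \<partial>gaussian_vector n \<sigma>)"
    proof (intro nn_integral_cong arg_cong[of _ _ h])
      fix \<epsilon> assume "\<epsilon> \<in> space (gaussian_vector n \<sigma>)"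
      then have "\<epsilon> \<in> extensional {..<n}"
        by (simp add: gaussian_vector_def space_PiM PiE_def)
      then show "\<epsilon> = (\<lambda>i\<in>{..<n}. 0 + \<epsilon> i)"
        by (simp add: extensional_restrict)
    qed
    also have "\<dots> = (\<integral>\<^sup>+ \<epsilon>. ennreal (w \<epsilon>) * h \<epsilon> \<partial>gaussian_vector n 1)"
      unfolding w_def by (rule nn_integral_gaussian_vector_shift[OF \<sigma>(1) h])
    finally show ?thesis .
  qed
  have w_pair[measurable]: "(\<lambda>(X, \<epsilon>). w \<epsilon>) \<in> borel_measurable ?P"
    by measurable
  have null: "(\<integral>\<^sup>+ x. ennreal ((g x - 1 / 2)\<^sup>2) \<partial>?P) \<le> max_risk n p k \<eta>'"
    using risk_le_max_risk[OF sparse, of 1 n \<eta>']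
    by (simp add: ev nn_integral_regression_law M2.nn_integral_fst [symmetric]) (simp add: g_def)
  have alt: "(\<integral>\<^sup>+ x. ennreal ((case x of (X, \<epsilon>) \<Rightarrow> w \<epsilon>) * (g x - 1 / (2 - \<delta>))\<^sup>2) \<partial>?P) \<le> max_risk n p k \<eta>'"
  proof -
    have "(\<integral>\<^sup>+ x. ennreal ((case x of (X, \<epsilon>) \<Rightarrow> w \<epsilon>) * (g x - 1 / (2 - \<delta>))\<^sup>2) \<partial>?P)
       = (\<integral>\<^sup>+ X. (\<integral>\<^sup>+ \<epsilon>. ennreal (w \<epsilon>) * ennreal ((g (X, \<epsilon>) - 1 / (2 - \<delta>))\<^sup>2) \<partial>gaussian_vector n 1) \<partial>gaussian_design n p)"
      using w0 by (subst M2.nn_integral_fst [symmetric]) (auto simp: ennreal_mult')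
    also have "\<dots> = (\<integral>\<^sup>+ X. (\<integral>\<^sup>+ \<epsilon>. ennreal ((g (X, \<epsilon>) - 1 / (2 - \<delta>))\<^sup>2) \<partial>gaussian_vector n \<sigma>) \<partial>gaussian_design n p)"
    proof (intro nn_integral_cong shift [symmetric])
      fix X assume "X \<in> space (gaussian_design n p)"
      then have "(\<lambda>\<epsilon>. g (X, \<epsilon>)) \<in> borel_measurable (gaussian_vector n 1)"
        by measurable
      then show "(\<lambda>\<epsilon>. ennreal ((g (X, \<epsilon>) - 1 / (2 - \<delta>))\<^sup>2)) \<in> borel_measurable (PiM {..<n} (\<lambda>_. borel))"
        by measurable
    qed
    also have "\<dots> = (\<integral>\<^sup>+ \<omega>. ennreal ((\<eta>' \<omega> - explained_variance p \<beta> \<sigma>)\<^sup>2) \<partial>regression_law n p \<beta> \<sigma>)"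
      by (subst nn_integral_regression_law[OF \<sigma>(1)]) (simp_all add: g_def ev)
    also have "\<dots> \<le> max_risk n p k \<eta>'"
      by (rule risk_le_max_risk[OF sparse \<sigma>(1)])
    finally show ?thesis .
  qed
  have "ennreal ((1 / (2 - \<delta>) - 1 / 2)\<^sup>2 / (2 * (1 + 2))) \<le> max_risk n p k \<eta>'"
  proof (rule two_point_lower_bound[OF w_pair g _ _ _ _ null alt])
    show "0 \<le> (case x of (X, \<epsilon>) \<Rightarrow> w \<epsilon>)" for x :: "(nat \<Rightarrow> nat \<Rightarrow> real) \<times> (nat \<Rightarrow> real)"
      by (simp add: split_beta w0)
    have "(\<integral>\<^sup>+ \<epsilon>. ennreal (w \<epsilon>) \<partial>gaussian_vector n 1) = 1"
      using shift[of "\<lambda>_. 1"] prob_space.emeasure_space_1[OF prob_space_gaussian_vector[OF \<sigma>(1)]]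
      by simp
    then show "(\<integral>\<^sup>+ x. ennreal (case x of (X, \<epsilon>) \<Rightarrow> w \<epsilon>) \<partial>?P) = 1"
      by (subst M2.nn_integral_fst [symmetric]) (auto simp: M1.emeasure_space_1)
    interpret product_sigma_finite "\<lambda>_::nat. std_normal_distribution" by (rule product_sigma_finite_std_normal)
    have "(\<integral>\<^sup>+ \<epsilon>. ennreal ((w \<epsilon>)\<^sup>2) \<partial>gaussian_vector n 1)
        = (\<integral>\<^sup>+ \<epsilon>. (\<Prod>i<n. ennreal ((normal_density 0 \<sigma> (\<epsilon> i) / std_normal_density (\<epsilon> i))\<^sup>2)) \<partial>gaussian_vector n 1)"
      by (simp add: w_def prod_power_distrib [symmetric] prod_ennreal del: prod_dividef)
    also have "\<dots> = (\<Prod>i<n. ennreal (1 / (\<sigma> * sqrt (2 - \<sigma>\<^sup>2))))"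
      unfolding gaussian_vector_def
      using \<sigma> \<delta> by (subst product_nn_integral_prod) (auto simp: normal_density_chi_square)
    also have "\<dots> = ennreal ((1 / sqrt (1 - \<delta>\<^sup>2)) ^ n)"
    proof -
      have "\<sigma> * sqrt (2 - \<sigma>\<^sup>2) = sqrt ((1 - \<delta>) * (1 + \<delta>))"
        unfolding \<sigma>(2) real_sqrt_mult by (simp add: \<sigma>_def)
      also have "(1 - \<delta>) * (1 + \<delta>) = 1 - \<delta>\<^sup>2"
        by (simp add: power2_eq_square algebra_simps)
      finally have "\<sigma> * sqrt (2 - \<sigma>\<^sup>2) = sqrt (1 - \<delta>\<^sup>2)" .
      moreover have "0 \<le> 1 - \<delta>\<^sup>2"
        using n by (simp add: \<delta>(3) field_simps)
      ultimately show ?thesis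
        by (simp add: ennreal_power)
    qed
    also have "\<dots> \<le> ennreal 2"
    proof (rule ennreal_leI)
      have \<delta>1: "\<delta>\<^sup>2 \<le> 1 / 4"
        using n by (simp add: \<delta>(3) field_simps)
      \<comment> \<open>Start of Bernoulli's inequality; \<open>1 / 4\<close> suffices, as its root
        \<open>1 / 2\<close> yields the bound 2.\<close>
      have "1 / 4 \<le> 1 + real n * (- \<delta>\<^sup>2)"
        using n by (simp add: \<delta>(3))
      also have "\<dots> \<le> (1 - \<delta>\<^sup>2) ^ n"
        using Bernoulli_inequality[of "- \<delta>\<^sup>2" n] \<delta>1 by simp
      also have "\<dots> = ((sqrt (1 - \<delta>\<^sup>2))\<^sup>2) ^ n"
        using \<delta>1 by simp
      also have "\<dots> = (sqrt (1 - \<delta>\<^sup>2) ^ n)\<^sup>2"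
        by (simp only: power_mult [symmetric] mult.commute)
      finally have "(1 / 2)\<^sup>2 \<le> (sqrt (1 - \<delta>\<^sup>2) ^ n)\<^sup>2"
        by (simp add: power2_eq_square)
      then have "1 / 2 \<le> sqrt (1 - \<delta>\<^sup>2) ^ n"
        using \<delta>1 by (auto dest: power2_le_imp_le)
      then show "(1 / sqrt (1 - \<delta>\<^sup>2)) ^ n \<le> 2"
        by (simp add: power_one_over field_simps)
    qed
    finally show "(\<integral>\<^sup>+ x. ennreal ((case x of (X, \<epsilon>) \<Rightarrow> w \<epsilon>)\<^sup>2) \<partial>?P) \<le> ennreal 2"
      by (subst M2.nn_integral_fst [symmetric]) (auto simp: M1.emeasure_space_1)
  qed simp
  moreover have "1 / (384 * real n) \<le> (1 / (2 - \<delta>) - 1 / 2)\<^sup>2 / (2 * (1 + 2))"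
  proof -
    \<comment> \<open>The difference equals \<open>\<delta> / (2 * (2 - \<delta>))\<close>.\<close>
    have "\<delta> / 4 \<le> 1 / (2 - \<delta>) - 1 / 2"
      using \<delta> by (simp add: field_simps)
    then have "(\<delta> / 4)\<^sup>2 \<le> (1 / (2 - \<delta>) - 1 / 2)\<^sup>2"
      using \<delta> by (intro power_mono) auto
    then show ?thesis
      by (simp add: power_divide \<delta>(3))
  qed
  ultimately show ?thesis
    using ennreal_leI order_trans by blast
qed

section \<open>The sparse rate\<close>

text \<open>On this range \<open>1 / (1 - x) \<le> 1 + 2 * x\<close>, and the right side is at most
  \<open>exp (2 * x)\<close>.\<close>

lemma inverse_power_le_exp:
  fixes x :: real
  assumes "0 \<le> x" "x \<le> 1 / 2"
  shows "1 / (1 - x) ^ n \<le> exp (2 * real n * x)"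
proof -
  have "1 \<le> (1 + 2 * x) * (1 - x)"
    using assms by (simp add: algebra_simps)
      (metis mult_left_mono mult.commute mult.left_commute mult.right_neutral times_divide_eq_right)
  also have "\<dots> \<le> exp (2 * x) * (1 - x)"
    using assms exp_ge_add_one_self[of "2 * x"] by (intro mult_right_mono) auto
  finally have "1 / (1 - x) \<le> exp (2 * x)"
    using assms by (simp add: field_simps)
  then have "(1 / (1 - x)) ^ n \<le> exp (2 * x) ^ n"
    using assms by (intro power_mono) auto
  then show ?thesis
    by (simp add: power_one_over exp_of_nat_mult [symmetric] mult_ac)
qed

text \<open>
  The first \<open>k * m\<close> coordinates are cut into \<open>k\<close> blocks of length \<open>m\<close>, and \<open>f\<close> selects one coordinate in
  each block. For uniform independent \<open>f\<close> and \<open>g\<close> the size of the overlap of the two supports is then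
  exactly binomial with parameters \<open>k\<close> and \<open>1 / m\<close>, instead of hypergeometric.
\<close>

definition block_vector :: "nat \<Rightarrow> nat \<Rightarrow> nat \<Rightarrow> real \<Rightarrow> (nat \<Rightarrow> nat) \<Rightarrow> nat \<Rightarrow> real" where
  "block_vector p k m a f = (\<lambda>j\<in>{..<p}. if j < k * m \<and> f (j div m) = j mod m then a else 0)"

text \<open>In block \<open>i\<close> only position \<open>f i\<close> can contribute, and it does
  so exactly when \<open>g\<close> selects it too. For \<open>g = f\<close> this is the squared norm
  \<open>k * a\<^sup>2\<close>.\<close>

lemma sum_block_vector:
  assumes f: "f \<in> {..<k} \<rightarrow> {..<m}" and "k * m \<le> p"
  shows "(\<Sum>j<p. block_vector p k m a f j * block_vector p k m a g j)
       = a\<^sup>2 * real (card {i \<in> {..<k}. f i = g i})"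
proof -
  let ?v = "block_vector p k m a"
  have "(\<Sum>j<p. ?v f j * ?v g j) = (\<Sum>j<k * m. ?v f j * ?v g j)"
    using assms(2) by (intro sum.mono_neutral_right) (auto simp: block_vector_def)
  also have "\<dots> = (\<Sum>i<k. \<Sum>j\<in>{i * m..<i * m + m}. ?v f j * ?v g j)"
    by (rule sum.nat_group [symmetric])
  also have "\<dots> = (\<Sum>i<k. if f i = g i then a\<^sup>2 else 0)"
  proof (intro sum.cong refl)
    fix i assume "i \<in> {..<k}"
    then have i: "i < k" "f i < m" using f by auto
    have "?v f (i * m + j) * ?v g (i * m + j) = (if j = f i then if f i = g i then a\<^sup>2 else 0 else 0)" if "j < m" for j
    proof -
      have "i * m + j < (i + 1) * m" using that by simp
      also have "\<dots> \<le> k * m" using i(1) by (intro mult_le_mono1) simp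
      finally have "i * m + j < k * m" .
      then show ?thesis
        using assms(2) that by (auto simp: block_vector_def power2_eq_square)
    qed
    then have "(\<Sum>j<m. ?v f (i * m + j) * ?v g (i * m + j)) = (if f i = g i then a\<^sup>2 else 0)"
      using i(2) by simp
    then show "(\<Sum>j\<in>{i * m..<i * m + m}. ?v f j * ?v g j) = (if f i = g i then a\<^sup>2 else 0)"
      using sum.shift_bounds_nat_ivl[of "\<lambda>j. ?v f j * ?v g j" 0 "i * m" m]
      by (simp add: atLeast0LessThan add.commute)
  qed
  also have "\<dots> = a\<^sup>2 * real (card {i \<in> {..<k}. f i = g i})"
    by (simp add: sum.If_cases Int_def)
  finally show ?thesis .
qed

lemma block_vector_sparse:
  assumes "f \<in> {..<k} \<rightarrow> {..<m}"
  shows "block_vector p k m a f \<in> sparse_vectors p k"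
proof -
  have "{j \<in> {..<p}. block_vector p k m a f j \<noteq> 0} \<subseteq> (\<lambda>i. i * m + f i) ` {..<k}"
  proof
    fix j assume "j \<in> {j \<in> {..<p}. block_vector p k m a f j \<noteq> 0}"
    then have "j < k * m" "f (j div m) = j mod m"
      by (auto simp: block_vector_def split: if_splits)
    then show "j \<in> (\<lambda>i. i * m + f i) ` {..<k}"
      by (intro image_eqI[of _ _ "j div m"]) (auto simp: less_mult_imp_div_less)
  qed
  then have "card {j \<in> {..<p}. block_vector p k m a f j \<noteq> 0} \<le> card {..<k}"
    by (rule surj_card_le[rotated]) simp
  then show ?thesis
    by (simp add: sparse_vectors_def block_vector_def)
qed

text \<open>Up to the factor \<open>m ^ k\<close> this is the generating function of a binomial
  variable: the power factors over blocks, and in each block one of the \<open>m\<close> choices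
  agrees with \<open>f\<close>. The value is free of \<open>f\<close>, so a further sum over
  \<open>f\<close> is immediate.\<close>

lemma sum_power_agreements:
  fixes q :: real
  assumes "f \<in> {..<k} \<rightarrow> {..<m}"
  shows "(\<Sum>g\<in>{..<k} \<rightarrow>\<^sub>E {..<m}. q ^ card {i \<in> {..<k}. f i = g i}) = (real m - 1 + q) ^ k"
proof -
  have "(\<Sum>g\<in>{..<k} \<rightarrow>\<^sub>E {..<m}. q ^ card {i \<in> {..<k}. f i = g i})
      = (\<Sum>g\<in>{..<k} \<rightarrow>\<^sub>E {..<m}. \<Prod>i<k. if f i = g i then q else 1)"
    by (intro sum.cong) (simp_all add: prod.If_cases Int_def)
  also have "\<dots> = (\<Prod>i<k. \<Sum>j<m. if f i = j then q else 1)"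
    by (rule prod_sum_PiE [symmetric]) auto
  also have "\<dots> = (\<Prod>i<k. real m - 1 + q)"
  proof (intro prod.cong refl)
    fix i assume "i \<in> {..<k}"
    then have "f i < m" using assms by auto
    moreover have "(\<Sum>j<m. if f i = j then q else 1) = (\<Sum>j<m. 1 + (if j = f i then q - 1 else 0))"
      by (intro sum.cong) auto
    ultimately show "(\<Sum>j<m. if f i = j then q else 1) = real m - 1 + q"
      by (simp add: sum.distrib)
  qed
  finally show ?thesis by simp
qed

text \<open>The prior lives on \<open>k'\<close> coordinates, possibly fewer than \<open>k\<close>.
  Its second moment is at most \<open>(1 + (q - 1) / m) ^ k'\<close>. The bound on
  \<open>\<theta>\<close> forces \<open>q - 1 \<le> m / k'\<close>, so this is at most
  \<open>exp 1 \<le> 3\<close>, and \<open>2 * (1 + 3) = 8\<close>.\<close>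

lemma max_risk_ge_sparse:
  assumes n: "n \<ge> 1" and k': "1 \<le> k'" "k' \<le> k" "k' \<le> p"
    and \<theta>: "0 \<le> \<theta>" "\<theta> \<le> 1 / 2" "\<theta> \<le> real k' / (4 * real n) * ln (1 + real p / (real k')\<^sup>2)"
    and \<eta>': "\<eta>' \<in> borel_measurable (obs_space n p)"
  shows "ennreal (\<theta>\<^sup>2 / 8) \<le> max_risk n p k \<eta>'"
proof -
  define m where "m = p div k'"
  \<comment> \<open>The \<open>k'\<close> nonzero entries of size \<open>a\<close> have squared norm
    \<open>\<theta>\<close>.\<close>
  define a where "a = sqrt (\<theta> / real k')"
  define q where "q = exp (2 * real n * \<theta> / real k')"
  define x where "x = real p / (real k')\<^sup>2"
  let ?F = "{..<k'} \<rightarrow>\<^sub>E {..<m}"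
  let ?b = "block_vector p k' m a"
  have a: "a\<^sup>2 = \<theta> / real k'"
    using \<theta>(1) by (simp add: a_def)
  have m: "m \<ge> 1" "k' * m \<le> p" "real p \<le> 2 * real k' * real m"
  proof -
    show m1: "m \<ge> 1"
      using k' by (simp add: m_def div_greater_zero_iff Suc_le_eq)
    show "k' * m \<le> p"
      by (simp add: m_def)
    \<comment> \<open>Rounding \<open>p / k'\<close> down costs at most a factor 2, because
      \<open>m\<close> is at least 1.\<close>
    have "p < k' * m + k'"
      unfolding m_def using k'(1) by (metis add.commute add_less_cancel_left div_mult_mod_eq le_eq_less_or_eq less_le_trans mod_less_divisor mult.commute zero_less_one)
    also have "\<dots> \<le> k' * m + k' * m"
      using m1 by simp
    finally have "real p \<le> real (2 * k' * m)"
      by (simp only: of_nat_le_iff)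
    then show "real p \<le> 2 * real k' * real m" by simp
  qed
  have x: "x > 0"
    using k' by (simp add: x_def)
  have q: "1 \<le> q" "q \<le> 1 + x / 2"
  proof -
    show "1 \<le> q" using \<theta>(1) by (simp add: q_def)
    \<comment> \<open>The 4 in the bound on \<open>\<theta>\<close> produces this
      \<open>1 / 2\<close>, hence a square root; \<open>sqrt (1 + x) \<le> 1 + x / 2\<close> then
      gains the factor 2 that pays for the rounding in \<open>m\<close>.\<close>
    have "2 * real n * \<theta> / real k' \<le> 1 / 2 * ln (1 + x)"
      using \<theta>(3) n k'(1) by (simp add: x_def field_simps)
    also have "\<dots> = ln (sqrt (1 + x))"
      using x by (simp add: ln_sqrt)
    finally have "q \<le> sqrt (1 + x)"
      using x by (simp add: q_def ln_ge_iff)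
    also have "\<dots> \<le> sqrt ((1 + x / 2)\<^sup>2)"
      by (intro real_sqrt_le_mono) (simp add: power2_eq_square algebra_simps)
    finally show "q \<le> 1 + x / 2" using x by simp
  qed
  have sparse: "?b f \<in> sparse_vectors p k" if "f \<in> ?F" for f
    using block_vector_sparse[of f k' m p a] that k'(2) by (fastforce simp: sparse_vectors_def PiE_def)
  have inner: "(\<Sum>j<p. ?b f j * ?b g j) = \<theta> / real k' * real (card {i \<in> {..<k'}. f i = g i})"
    if "f \<in> ?F" for f g
    using sum_block_vector[of f k' m p a g] that m(2) a by (simp add: PiE_def)
  have "(\<Sum>f\<in>?F. \<Sum>g\<in>?F. 1 / (1 - (\<Sum>j<p. ?b f j * ?b g j)) ^ n)
      \<le> (\<Sum>f\<in>?F. \<Sum>g\<in>?F. q ^ card {i \<in> {..<k'}. f i = g i})"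
  proof (intro sum_mono)
    fix f g assume fg: "f \<in> ?F" "g \<in> ?F"
    let ?c = "card {i \<in> {..<k'}. f i = g i}"
    have "?c \<le> card {..<k'}"
      by (intro card_mono) auto
    then have "real ?c \<le> real k'" by simp
    then have "\<theta> / real k' * real ?c \<le> \<theta>"
      using \<theta>(1) k'(1) mult_left_mono[of "real ?c" "real k'" "\<theta> / real k'"] by simp
    then have "\<theta> / real k' * real ?c \<le> 1 / 2"
      using \<theta>(2) by linarith
    then have "1 / (1 - \<theta> / real k' * real ?c) ^ n \<le> exp (2 * real n * (\<theta> / real k' * real ?c))"
      using \<theta>(1) by (intro inverse_power_le_exp) simp_all
    also have "\<dots> = q ^ ?c"
      by (simp add: q_def exp_of_nat_mult [symmetric] mult_ac)
    finally show "1 / (1 - (\<Sum>j<p. ?b f j * ?b g j)) ^ n \<le> q ^ ?c"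
      by (simp add: inner[OF fg(1)])
  qed
  also have "\<dots> = (\<Sum>f\<in>?F. (real m - 1 + q) ^ k')"
    by (intro sum.cong refl sum_power_agreements) auto
  also have "\<dots> = real m ^ k' * (real m - 1 + q) ^ k'"
    by (simp add: card_PiE)
  also have "(real m - 1 + q) ^ k' \<le> (real m * exp (1 / real k')) ^ k'"
  proof (rule power_mono)
    have "q - 1 \<le> x / 2" using q by simp
    also have "x / 2 \<le> real m / real k'"
      using m(3) k'(1) by (simp add: x_def power2_eq_square field_simps)
    finally have "real m - 1 + q \<le> real m * (1 + 1 / real k')"
      by (simp add: algebra_simps)
    also have "\<dots> \<le> real m * exp (1 / real k')"
      by (intro mult_left_mono exp_ge_add_one_self_aux) auto
    finally show "real m - 1 + q \<le> real m * exp (1 / real k')" .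
  qed (use m(1) q(1) in auto)
  also have "real m ^ k' * (real m * exp (1 / real k')) ^ k' = exp 1 * (real (card ?F))\<^sup>2"
    using k'(1) by (simp add: card_PiE power_mult_distrib exp_of_nat_mult [symmetric] power2_eq_square)
  also have "\<dots> \<le> 3 * (real (card ?F))\<^sup>2"
    by (intro mult_right_mono) (use exp_le in auto)
  finally have M: "(\<Sum>f\<in>?F. \<Sum>g\<in>?F. 1 / (1 - (\<Sum>j<p. ?b f j * ?b g j)) ^ n) \<le> 3 * (real (card ?F))\<^sup>2"
    by (simp add: mult_left_mono)
  have "ennreal (\<theta>\<^sup>2 / (2 * (1 + 3))) \<le> max_risk n p k \<eta>'"
  proof (rule max_risk_ge_mixture[where F = ?F and b = ?b])
    show "finite ?F" by (intro finite_PiE) auto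
    show "?F \<noteq> {}" using m(1) by (auto simp: PiE_eq_empty_iff lessThan_empty_iff)
    show "(\<Sum>j<p. (?b f j)\<^sup>2) = \<theta>" if "f \<in> ?F" for f
      using inner[OF that, of f] k'(1) by (simp add: power2_eq_square)
    show "?b f j * ?b g j = 0 \<or> ?b f j = ?b g j" if "j < p" for f g j
      using that by (simp add: block_vector_def)
  qed (use sparse \<theta> M \<eta>' in auto)
  then show ?thesis by simp
qed

text \<open>The inner maximum is \<open>p / k\<^sup>2\<close> when \<open>k\<^sup>2 \<le> p\<close>
  and its square root otherwise. In both regimes \<open>max_risk_ge_sparse\<close> is applied with
  \<open>\<theta> = min T 1 / 16\<close>, whence \<open>2048 = 8 * 16\<^sup>2\<close>; only the
  choice of \<open>k'\<close> differs.\<close>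

lemma max_risk_ge_high_dimensional:
  assumes n: "n \<ge> 1" and p: "p \<ge> 1" and k: "1 \<le> k" "k \<le> p"
    and \<eta>': "\<eta>' \<in> borel_measurable (obs_space n p)"
  defines "T \<equiv> real k / real n * ln (1 + max (real p / (real k)\<^sup>2) (sqrt (real p / (real k)\<^sup>2)))"
  shows "ennreal (min (T\<^sup>2) 1 / 2048) \<le> max_risk n p k \<eta>'"
proof -
  have T0: "0 \<le> T"
    unfolding T_def by (intro mult_nonneg_nonneg ln_ge_zero) (auto simp: le_max_iff_disj)
  have main: "ennreal (min (T\<^sup>2) 1 / 2048) \<le> max_risk n p k \<eta>'"
    if k': "1 \<le> k'" "k' \<le> k" and le: "T / 16 \<le> real k' / (4 * real n) * ln (1 + real p / (real k')\<^sup>2)" for k'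
  proof -
    define \<theta> where "\<theta> = min T 1 / 16"
    have "ennreal (\<theta>\<^sup>2 / 8) \<le> max_risk n p k \<eta>'"
      using n k k' le T0 \<eta>' by (intro max_risk_ge_sparse[of n k']) (auto simp: \<theta>_def)
    moreover have "(min T 1)\<^sup>2 = min (T\<^sup>2) 1"
      using T0 by (auto simp: min_def power_le_one_iff abs_square_le_1 one_le_power)
    ultimately show ?thesis
      by (simp add: \<theta>_def power_divide)
  qed
  show ?thesis
  proof (cases "k\<^sup>2 \<le> p")
    case True
    then have "(real k)\<^sup>2 \<le> real p"
      by (metis of_nat_le_iff of_nat_power)
    then have x: "1 \<le> real p / (real k)\<^sup>2"
      using k by simp
    then have "sqrt (real p / (real k)\<^sup>2) \<le> real p / (real k)\<^sup>2"
      using real_le_lsqrt[of "real p / (real k)\<^sup>2"] by (simp add: real_le_lsqrt self_le_power)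
    then have "T = real k / real n * ln (1 + real p / (real k)\<^sup>2)"
      by (simp add: T_def max_absorb1)
    then have "T / 4 = real k / (4 * real n) * ln (1 + real p / (real k)\<^sup>2)"
      by simp
    then have "T / 16 \<le> real k / (4 * real n) * ln (1 + real p / (real k)\<^sup>2)"
      using T0 by linarith
    then show ?thesis
      using k by (intro main[of k]) auto
  next
    case False
    then have "real p < (real k)\<^sup>2"
      by (metis not_le of_nat_less_iff of_nat_power)
    then have x: "0 < real p / (real k)\<^sup>2" "real p / (real k)\<^sup>2 \<le> 1"
      using k p by simp_all
    have s: "sqrt (real p / (real k)\<^sup>2) = sqrt (real p) / real k"
      by (simp add: real_sqrt_divide)
    have "real p / (real k)\<^sup>2 \<le> sqrt (real p / (real k)\<^sup>2)"
      using x power_decreasing[of 1 2 "real p / (real k)\<^sup>2"] by (intro real_le_rsqrt) simp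
    then have "T = real k / real n * ln (1 + sqrt (real p) / real k)"
      by (simp add: T_def max_absorb2 s)
    \<comment> \<open>By \<open>ln (1 + u) \<le> u\<close> the dependence on \<open>k\<close>
      cancels.\<close>
    also have "\<dots> \<le> real k / real n * (sqrt (real p) / real k)"
      by (intro mult_left_mono ln_add_one_self_le_self) auto
    finally have T: "T \<le> sqrt (real p) / real n"
      using k by simp
    \<comment> \<open>In the dense regime a prior on only about \<open>sqrt p\<close> coordinates already gives the rate.\<close>
    define k' where "k' = nat \<lfloor>sqrt (real p)\<rfloor>"
    have sp: "1 \<le> sqrt (real p)" using p by simp
    have k'1: "1 \<le> k'"
      using sp by (simp add: k'_def le_nat_floor)
    have k'le: "real k' \<le> sqrt (real p)" and k'gt: "sqrt (real p) < real k' + 1"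
      using sp unfolding k'_def by (linarith, linarith)
    have "sqrt (real p) \<le> real k"
      using \<open>real p < (real k)\<^sup>2\<close> by (intro real_le_lsqrt) auto
    then have k'2: "k' \<le> k"
      using k'le by linarith
    have "(real k')\<^sup>2 \<le> real p"
      using k'le power_mono[OF k'le, of 2] by simp
    then have "1 \<le> real p / (real k')\<^sup>2"
      using k'1 by simp
    then have "ln 2 \<le> ln (1 + real p / (real k')\<^sup>2)"
      by (intro ln_mono) auto
    then have ln: "1 / 2 \<le> ln (1 + real p / (real k')\<^sup>2)"
      using ln2_ge_two_thirds by linarith
    \<comment> \<open>Here \<open>16 = 2 * 4 * 2\<close>: the floor loses at most a factor 2, as
      \<open>sqrt p < k' + 1 \<le> 2 * k'\<close>; the 4 comes from the bound on
      \<open>\<theta>\<close>; the logarithm is at least \<open>1 / 2\<close>.\<close>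
    have "T / 16 \<le> sqrt (real p) / 2 / (4 * real n) * (1 / 2)"
      using T by simp
    also have "\<dots> \<le> real k' / (4 * real n) * (1 / 2)"
      using k'1 k'gt by (intro mult_right_mono divide_right_mono) auto
    also have "\<dots> \<le> real k' / (4 * real n) * ln (1 + real p / (real k')\<^sup>2)"
      by (intro mult_left_mono ln) auto
    finally show ?thesis
      by (rule main[OF k'1 k'2])
  qed
qed

theorem proposition2p4:
  "\<exists>C::real. C > 0 \<and>
     (\<forall>n p k :: nat. n \<ge> 1 \<longrightarrow> p \<ge> 1 \<longrightarrow> 1 \<le> k \<longrightarrow> k \<le> p \<longrightarrow>
        minimax_risk n p k \<ge>
          ennreal (C * (min ((real k / real n
              * ln (1 + max (real p / (real k)\<^sup>2) (sqrt (real p / (real k)\<^sup>2))))\<^sup>2) 1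
            + 1 / real n)))"
proof (intro exI[of _ "1 / 4096 :: real"] conjI allI impI)
  fix n p k :: nat
  assume n: "n \<ge> 1" and p: "p \<ge> 1" and k: "1 \<le> k" "k \<le> p"
  let ?T = "min ((real k / real n
              * ln (1 + max (real p / (real k)\<^sup>2) (sqrt (real p / (real k)\<^sup>2))))\<^sup>2) 1"
  \<comment> \<open>A sum is at most twice the maximum: \<open>4096 = 2 * 2048\<close>, which also
    exceeds \<open>2 * 384\<close>.\<close>
  have le: "1 / 4096 * (?T + 1 / real n) \<le> max (?T / 2048) (1 / (384 * real n))"
  proof -
    have "1 / 4096 * (1 / real n) \<le> 1 / 2 * (1 / (384 * real n))"
      using n by (simp add: field_simps)
    moreover have "?T / 2048 \<le> max (?T / 2048) (1 / (384 * real n))"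
      "1 / (384 * real n) \<le> max (?T / 2048) (1 / (384 * real n))" by simp_all
    ultimately show ?thesis by argo
  qed
  have "ennreal (max (?T / 2048) (1 / (384 * real n))) \<le> max_risk n p k \<eta>'"
    if "\<eta>' \<in> borel_measurable (obs_space n p)" for \<eta>'
    using max_risk_ge_parametric[OF n p k(1) that] max_risk_ge_high_dimensional[OF n p k that]
    unfolding max_def by (simp split: if_split)
  then show "ennreal (1 / 4096 * (?T + 1 / real n)) \<le> minimax_risk n p k"
    unfolding minimax_risk_def
    by (intro INF_greatest order_trans[OF ennreal_leI[OF le]])
qed simp

end
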